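(* Let $u_1:\partial D_\zeta\to\mathbb{R}$ and $u_3:\partial D_\zeta\to\mathbb{R}$ be functions each satisfying the Dini condition $\int_0^1\frac{\omega(u_k,\eta)}{\eta}\,d\eta<\infty$ ($k=1,3$). Then the (1-3)-problem for the disk $D_\zeta$ with data $u_1,u_3$ is solvable in the class $\mathcal{M}$ if and only if $$\int_{\partial D_\zeta}u_1(\zeta)\,dx+u_3(\zeta)\,dy=0 .$$ When this condition is satisfied, the general solution (in the class $\mathcal{M}$) is expressed in the form $$\Phi(\zeta)=S_{D_\zeta}[u_1](\zeta)\,e_1+S_{D_\zeta}[u_3](\zeta)\,e_2+b\zeta+b_1e_1+b_2e_2+i(a\zeta+a_1e_1+a_2e_2)\qquad(\zeta\in D_\zeta),$$ where $$b=-\frac1{2\pi}\operatorname{Re}\int_{\partial D}\frac{\widehat u_3(t)}{t^2}\,dt-\frac1{2\pi}\operatorname{Im}\int_{\partial D}\frac{\widehat u_1(t)}{t^2}\,dt,$$ $$b_1=-\frac1{2\pi}\operatorname{Re}\int_{\partial D}\frac{\widehat u_3(t)}{t^3}\,dt-\frac1{2\pi}\operatorname{Im}\int_{\partial D}\frac{\widehat u_1(t)}{t^3}\,dt,$$ $$b_2=\frac1{2\pi}\operatorname{Im}\int_{\partial D}\frac{\widehat u_3(t)}{t^3}\,dt-\frac1{2\pi}\operatorname{Re}\int_{\partial D}\frac{\widehat u_1(t)}{t^3}\,dt,$$ and $a,a_1,a_2$ are arbitrary real constants.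
   Context: Algebra: $\mathbb{B}$ is the commutative associative two-dimensional algebra over $\mathbb{C}$ with basis $\{e_1,e_2\}$, where $e_1=1$ is the unit and $e_2^2=e_1+2ie_2$ ($i$ is the complex imaginary unit). Norm: $\|z_1e_1+z_2e_2\|=\sqrt{|z_1|^2+|z_2|^2}$ for $z_1,z_2\in\mathbb{C}$. The biharmonic plane is $\mu=\{\zeta=xe_1+ye_2: x,y\in\mathbb{R}\}$; all its nonzero elements are invertible in $\mathbb{B}$. Throughout $\zeta=xe_1+ye_2$ and $z=x+iy$ with $x,y\in\mathbb{R}$. Monogenic: for a domain $\Omega\subset\mu$, a function $\Phi:\Omega\to\mathbb{B}$ is monogenic in $\Omega$ if for every $\zeta\in\Omega$ the limit $\Phi'(\zeta)=\lim_{h\to0,\,h\in\mu}(\Phi(\zeta+h)-\Phi(\zeta))h^{-1}$ exists. Components: every $\Phi$ with values in $\mathbb{B}$ is written $\Phi(\zeta)=U_1(x,y)e_1+U_2(x,y)ie_1+U_3(x,y)e_2+U_4(x,y)ie_2$ with real-valued $U_1,\dots,U_4$. Disks: $D_\zeta=\{\zeta=xe_1+ye_2\in\mu:\|\zeta\|<1\}$ is the unit disk of $\mu$ with boundary circle $\partial D_\zeta$ and closure $\overline{D_\zeta}$; $D=\{z\in\mathbb{C}:|z|<1\}$ with boundary $\partial D$. Circles are oriented counterclockwise. For $u:\partial D_\zeta\to\mathbb{R}$, $\widehat u:\partial D\to\mathbb{R}$ is defined by $\widehat u(x+iy)=u(xe_1+ye_2)$. For $\tau=t_1e_1+t_2e_2\in\mu$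 one sets $d\tau=e_1dt_1+e_2dt_2$. Modulus of continuity: $\omega(u,\varepsilon)=\sup\{\|u(\tau_1)-u(\tau_2)\|:\tau_1,\tau_2\in\partial D_\zeta,\ \|\tau_1-\tau_2\|\le\varepsilon\}$, for real- or $\mathbb{B}$-valued functions $u$ on $\partial D_\zeta$. (1-3)-problem for $D_\zeta$ with data $u_1,u_3$: find a continuous function $\Phi:\overline{D_\zeta}\to\mathbb{B}$ which is monogenic in $D_\zeta$ and whose components satisfy $U_1(x,y)=u_1(\zeta)$ and $U_3(x,y)=u_3(\zeta)$ for all $\zeta\in\partial D_\zeta$. Integral and class $\mathcal{M}$: for $u:\partial D_\zeta\to\mathbb{R}$ put $$S_{D_\zeta}[u](\zeta)=\frac1{2\pi i}\int_{\partial D_\zeta}u(\tau)(\tau+\zeta)(\tau-\zeta)^{-1}\tau^{-1}\,d\tau,\qquad \zeta\in D_\zeta$$ (inverses in $\mathbb{B}$). $\mathcal{M}$ is the class of functions $\Phi$ that can be represented in $D_\zeta$ as $$\Phi(\zeta)=\frac1{2\pi i}\int_{\partial D_\zeta}\varphi(\tau)(\tau+\zeta)(\tau-\zeta)^{-1}\tau^{-1}\,d\tau,\qquad \zeta\in D_\zeta,$$ for some $\varphi:\partial D_\zeta\to\mathbb{B}$ satisfying $\int_0^1\frac{\omega(\varphi,\eta)}{\eta}\,d\eta<\infty$; values on $\partial D_\zeta$ are the limiting values from inside $D_\zeta$. *)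

theory Defs
  imports "HOL-Complex_Analysis.Complex_Analysis"
begin

section \<open>The biharmonic algebra\<close>

text \<open>\<open>Bih z\<^sub>1 z\<^sub>2\<close> stands for \<open>z\<^sub>1 e\<^sub>1 + z\<^sub>2 e\<^sub>2\<close> with complex coefficients; see
  \<open>e2_square\<close> and \<open>Bih_eq\<close> below. The norm is the Euclidean one, which is not submultiplicative,
  so the type is not an instance of \<open>real_normed_algebra\<close>.\<close>

datatype bih = Bih (coeff1: complex) (coeff2: complex)

lemma bih_eq_iff: "x = y \<longleftrightarrow> coeff1 x = coeff1 y \<and> coeff2 x = coeff2 y"
  by (cases x; cases y) auto

instantiation bih :: comm_ring_1
begin

definition zero_bih :: bih where "0 = Bih 0 0"
definition one_bih :: bih where "1 = Bih 1 0"
definition plus_bih :: "bih \<Rightarrow> bih \<Rightarrow> bih"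
  where "v + w = Bih (coeff1 v + coeff1 w) (coeff2 v + coeff2 w)"
definition uminus_bih :: "bih \<Rightarrow> bih"
  where "- v = Bih (- coeff1 v) (- coeff2 v)"
definition minus_bih :: "bih \<Rightarrow> bih \<Rightarrow> bih"
  where "v - w = Bih (coeff1 v - coeff1 w) (coeff2 v - coeff2 w)"
definition times_bih :: "bih \<Rightarrow> bih \<Rightarrow> bih"
  where "v * w = Bih (coeff1 v * coeff1 w + coeff2 v * coeff2 w)
    (coeff1 v * coeff2 w + coeff2 v * coeff1 w + 2 * \<i> * coeff2 v * coeff2 w)"

instance
  by standard
    (simp_all add: zero_bih_def one_bih_def plus_bih_def uminus_bih_def minus_bih_def
      times_bih_def bih_eq_iff algebra_simps)

end

instantiation bih :: real_vector
begin

definition scaleR_bih :: "real \<Rightarrow> bih \<Rightarrow> bih"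
  where "r *\<^sub>R v = Bih (r *\<^sub>R coeff1 v) (r *\<^sub>R coeff2 v)"

instance
  by standard (simp_all add: scaleR_bih_def plus_bih_def algebra_simps)

end

instantiation bih :: euclidean_space
begin

definition norm_bih_def:
  "norm (v :: bih) = sqrt ((cmod (coeff1 v))\<^sup>2 + (cmod (coeff2 v))\<^sup>2)"
definition inner_bih_def:
  "(v :: bih) \<bullet> w = coeff1 v \<bullet> coeff1 w + coeff2 v \<bullet> coeff2 w"
definition sgn_bih_def: "sgn (v :: bih) = v /\<^sub>R norm v"
definition dist_bih_def: "dist (v :: bih) w = norm (v - w)"
definition uniformity_bih_def:
  "(uniformity :: (bih \<times> bih) filter) = (INF e\<in>{0 <..}. principal {(v, w). dist v w < e})"
definition open_bih_def:
  "open (U :: bih set) \<longleftrightarrow> (\<forall>v\<in>U. eventually (\<lambda>(v', w). v' = v \<longrightarrow> w \<in> U) uniformity)"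
definition Basis_bih_def:
  "(Basis :: bih set) = (\<lambda>b. Bih b 0) ` Basis \<union> Bih 0 ` Basis"

instance
proof
  fix r :: real and u v w :: bih and U :: "bih set"
  show "sgn v = v /\<^sub>R norm v" "dist v w = norm (v - w)"
    by (simp_all add: sgn_bih_def dist_bih_def)
  show "uniformity = (INF e\<in>{0 <..}. principal {(v :: bih, w). dist v w < e})"
    by (rule uniformity_bih_def)
  show "open U \<longleftrightarrow> (\<forall>v\<in>U. \<forall>\<^sub>F (v', w) in uniformity. v' = v \<longrightarrow> w \<in> U)"
    by (rule open_bih_def)
  show "v \<bullet> w = w \<bullet> v" "(u + v) \<bullet> w = u \<bullet> w + v \<bullet> w" "r *\<^sub>R v \<bullet> w = r * (v \<bullet> w)" "0 \<le> v \<bullet> v"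
    by (simp_all add: inner_bih_def plus_bih_def scaleR_bih_def inner_commute inner_add_left
        algebra_simps)
  show "v \<bullet> v = 0 \<longleftrightarrow> v = 0"
    by (simp add: inner_bih_def zero_bih_def bih_eq_iff add_nonneg_eq_0_iff)
  show "norm v = sqrt (v \<bullet> v)"
    by (simp add: inner_bih_def norm_bih_def power2_norm_eq_inner)
  show "(Basis :: bih set) \<noteq> {}" "finite (Basis :: bih set)"
    by (simp_all add: Basis_bih_def)
  show "(\<forall>b\<in>Basis. v \<bullet> b = 0) \<longleftrightarrow> v = 0"
    by (auto simp: Basis_bih_def inner_bih_def zero_bih_def bih_eq_iff ball_Un
        euclidean_all_zero_iff)
next
  fix v w :: bih
  assume "v \<in> Basis" "w \<in> Basis"
  then show "v \<bullet> w = (if v = w then 1 else 0)"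
    by (auto simp: Basis_bih_def inner_bih_def inner_Basis split: if_splits)
qed

end

text \<open>The value at non-invertible elements is a dummy.\<close>

definition bih_inverse :: "bih \<Rightarrow> bih"
  where "bih_inverse v = (if \<exists>w. v * w = 1 then THE w. v * w = 1 else 0)"

lemma bih_inverse_unique:
  fixes v w :: bih
  assumes "v * w = 1"
  shows "bih_inverse v = w"
proof -
  have "w' = w" if "v * w' = 1" for w'
  proof -
    have "w' = (w * v) * w'"
      using assms by (simp add: mult.commute)
    also have "\<dots> = w"
      using that by (simp add: mult.assoc)
    finally show ?thesis .
  qed
  then have "(THE w. v * w = 1) = w"
    using assms by (rule the_equality[rotated])
  moreover have "\<exists>w. v * w = 1"
    using assms by (rule exI)
  ultimately show ?thesis
    by (simp only: bih_inverse_def if_True)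
qed

abbreviation e1 :: bih where "e1 \<equiv> 1"
definition e2 :: bih where "e2 = Bih 0 1"

definition bih_of_complex :: "complex \<Rightarrow> bih" where "bih_of_complex z = Bih z 0"

lemma e2_square: "e2 * e2 = e1 + bih_of_complex (2 * \<i>) * e2"
  by (simp add: e2_def bih_of_complex_def times_bih_def plus_bih_def one_bih_def)

lemma Bih_eq: "Bih z w = bih_of_complex z * e1 + bih_of_complex w * e2"
  by (simp add: e2_def bih_of_complex_def times_bih_def plus_bih_def one_bih_def)

definition U1 :: "bih \<Rightarrow> real" where "U1 w = Re (coeff1 w)"
definition U2 :: "bih \<Rightarrow> real" where "U2 w = Im (coeff1 w)"
definition U3 :: "bih \<Rightarrow> real" where "U3 w = Re (coeff2 w)"
definition U4 :: "bih \<Rightarrow> real" where "U4 w = Im (coeff2 w)"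

lemma bih_components:
  "w = U1 w *\<^sub>R e1 + U2 w *\<^sub>R (bih_of_complex \<i> * e1)
     + U3 w *\<^sub>R e2 + U4 w *\<^sub>R (bih_of_complex \<i> * e2)"
  by (simp add: bih_eq_iff complex_eq_iff U1_def U2_def U3_def U4_def e2_def bih_of_complex_def
      times_bih_def plus_bih_def one_bih_def scaleR_bih_def)


section \<open>The biharmonic plane, monogenic functions, the unit disk\<close>

definition plane_pt :: "real \<Rightarrow> real \<Rightarrow> bih" where "plane_pt x y = x *\<^sub>R e1 + y *\<^sub>R e2"

definition bih_plane :: "bih set" where "bih_plane = {plane_pt x y | x y. True}"

lemma Bih_mult_eq_1:
  assumes "z + \<i> * w \<noteq> 0"
  shows "Bih z w * Bih ((z + 2 * \<i> * w) / (z + \<i> * w)\<^sup>2) (- w / (z + \<i> * w)\<^sup>2) = 1"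
proof -
  define q where "q = (z + \<i> * w)\<^sup>2"
  have "q \<noteq> 0"
    using assms by (simp add: q_def)
  have i_sq: "\<i> * \<i> = -1"
    by simp
  have 1: "z * (z + 2 * \<i> * w) + w * (- w) = q"
    using i_sq unfolding q_def power2_eq_square by algebra
  have 2: "z * (- w) + w * (z + 2 * \<i> * w) + 2 * \<i> * w * (- w) = 0"
    by (simp add: algebra_simps)
  have "z * ((z + 2 * \<i> * w) / q) + w * (- w / q) = 1"
    unfolding times_divide_eq_right add_divide_distrib[symmetric] 1 using \<open>q \<noteq> 0\<close> by simp
  moreover have "z * (- w / q) + w * ((z + 2 * \<i> * w) / q) + 2 * \<i> * w * (- w / q) = 0"
    unfolding times_divide_eq_right add_divide_distrib[symmetric] 2 by simp
  ultimately show ?thesis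
    by (simp only: q_def times_bih_def one_bih_def bih.sel)
qed

lemma bih_plane_invertible:
  assumes "\<zeta> \<in> bih_plane" "\<zeta> \<noteq> 0"
  shows "\<zeta> * bih_inverse \<zeta> = 1"
proof -
  obtain x y where "\<zeta> = plane_pt x y"
    using assms(1) unfolding bih_plane_def by blast
  then have \<zeta>: "\<zeta> = Bih (of_real x) (of_real y)"
    by (simp add: plane_pt_def e2_def one_bih_def plus_bih_def scaleR_bih_def complex_eq_iff)
  have "of_real x + \<i> * of_real y \<noteq> (0 :: complex)"
    using assms(2) by (auto simp: \<zeta> zero_bih_def complex_eq_iff)
  from Bih_mult_eq_1[OF this] show ?thesis
    unfolding \<zeta> by (simp only: bih_inverse_unique)
qed

text \<open>Meant for sets \<open>\<Omega>\<close> that are open relative to \<open>bih_plane\<close>: then \<open>\<zeta> + h\<close> eventually stays in \<open>\<Omega>\<close>,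
  and values of \<open>\<Phi>\<close> outside \<open>\<Omega>\<close> play no role.\<close>

definition monogenic_on :: "bih set \<Rightarrow> (bih \<Rightarrow> bih) \<Rightarrow> bool"
  where "monogenic_on \<Omega> \<Phi> \<longleftrightarrow>
    (\<forall>\<zeta>\<in>\<Omega>. \<exists>L. ((\<lambda>h. (\<Phi> (\<zeta> + h) - \<Phi> \<zeta>) * bih_inverse h) \<longlongrightarrow> L) (at 0 within bih_plane))"

definition disk :: "bih set" where "disk = {\<zeta> \<in> bih_plane. norm \<zeta> < 1}"
definition cdisk :: "bih set" where "cdisk = {\<zeta> \<in> bih_plane. norm \<zeta> \<le> 1}"
definition bdisk :: "bih set" where "bdisk = {\<zeta> \<in> bih_plane. norm \<zeta> = 1}"

definition hat :: "(bih \<Rightarrow> real) \<Rightarrow> complex \<Rightarrow> real"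
  where "hat u z = u (plane_pt (Re z) (Im z))"

definition mod_cont :: "(bih \<Rightarrow> 'a :: real_normed_vector) \<Rightarrow> real \<Rightarrow> ennreal"
  where "mod_cont u \<epsilon> = (SUP (\<tau>\<^sub>1, \<tau>\<^sub>2) \<in> {(\<tau>\<^sub>1, \<tau>\<^sub>2). \<tau>\<^sub>1 \<in> bdisk \<and> \<tau>\<^sub>2 \<in> bdisk \<and> norm (\<tau>\<^sub>1 - \<tau>\<^sub>2) \<le> \<epsilon>}.
    ennreal (norm (u \<tau>\<^sub>1 - u \<tau>\<^sub>2)))"

definition Dini :: "(bih \<Rightarrow> 'a :: real_normed_vector) \<Rightarrow> bool"
  where "Dini u \<longleftrightarrow> (\<integral>\<^sup>+ \<eta>\<in>{0<..1}. (mod_cont u \<eta> / ennreal \<eta>) \<partial>lborel) < \<infinity>"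


section \<open>Integrals over the unit circle of the plane\<close>

definition circ :: "real \<Rightarrow> bih" where "circ \<theta> = plane_pt (cos \<theta>) (sin \<theta>)"

definition circ_deriv :: "real \<Rightarrow> bih" where "circ_deriv \<theta> = plane_pt (- sin \<theta>) (cos \<theta>)"

lemma circ_has_vector_derivative: "(circ has_vector_derivative circ_deriv \<theta>) (at \<theta>)"
proof -
  have "((\<lambda>\<theta>. cos \<theta> *\<^sub>R e1 + sin \<theta> *\<^sub>R e2) has_vector_derivative
      (- sin \<theta> *\<^sub>R e1) + cos \<theta> *\<^sub>R e2) (at \<theta>)"
    using has_vector_derivative_add[OF
        has_vector_derivative_scaleR[OF DERIV_cos has_vector_derivative_const]
        has_vector_derivative_scaleR[OF DERIV_sin has_vector_derivative_const]]
    by simp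
  then show ?thesis
    unfolding circ_def[abs_def] circ_deriv_def plane_pt_def by simp
qed

text \<open>The integrals of \<open>f(\<tau>) d\<tau>\<close>, where \<open>d\<tau> = e\<^sub>1 dt\<^sub>1 + e\<^sub>2 dt\<^sub>2\<close>, and of \<open>p dx + q dy\<close> over the
  counterclockwise unit circle.\<close>

definition circ_integral :: "(bih \<Rightarrow> bih) \<Rightarrow> bih"
  where "circ_integral f = integral {0..2 * pi} (\<lambda>\<theta>. f (circ \<theta>) * circ_deriv \<theta>)"

definition circ_form_integral :: "(bih \<Rightarrow> real) \<Rightarrow> (bih \<Rightarrow> real) \<Rightarrow> real"
  where "circ_form_integral p q =
    integral {0..2 * pi} (\<lambda>\<theta>. p (circ \<theta>) * (- sin \<theta>) + q (circ \<theta>) * cos \<theta>)"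

definition schwarz_integral :: "(bih \<Rightarrow> bih) \<Rightarrow> bih \<Rightarrow> bih"
  where "schwarz_integral \<phi> \<zeta> = bih_of_complex (1 / (2 * of_real pi * \<i>)) *
    circ_integral (\<lambda>\<tau>. \<phi> \<tau> * (\<tau> + \<zeta>) * bih_inverse (\<tau> - \<zeta>) * bih_inverse \<tau>)"

definition S_disk :: "(bih \<Rightarrow> real) \<Rightarrow> bih \<Rightarrow> bih"
  where "S_disk u = schwarz_integral (\<lambda>\<tau>. u \<tau> *\<^sub>R e1)"


section \<open>The boundary value problem\<close>

definition boundary_limits :: "(bih \<Rightarrow> bih) \<Rightarrow> bool"
  where "boundary_limits \<Phi> \<longleftrightarrow> (\<forall>\<zeta>\<in>bdisk. (\<Phi> \<longlongrightarrow> \<Phi> \<zeta>) (at \<zeta> within disk))"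

definition class_M :: "(bih \<Rightarrow> bih) set"
  where "class_M = {\<Phi>. (\<exists>\<phi> :: bih \<Rightarrow> bih. Dini \<phi> \<and> (\<forall>\<zeta>\<in>disk. \<Phi> \<zeta> = schwarz_integral \<phi> \<zeta>))
    \<and> boundary_limits \<Phi>}"

definition solves_13 :: "(bih \<Rightarrow> real) \<Rightarrow> (bih \<Rightarrow> real) \<Rightarrow> (bih \<Rightarrow> bih) \<Rightarrow> bool"
  where "solves_13 u\<^sub>1 u\<^sub>3 \<Phi> \<longleftrightarrow> continuous_on cdisk \<Phi> \<and> monogenic_on disk \<Phi> \<and>
    (\<forall>\<zeta>\<in>bdisk. U1 (\<Phi> \<zeta>) = u\<^sub>1 \<zeta> \<and> U3 (\<Phi> \<zeta>) = u\<^sub>3 \<zeta>)"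

end

theory Submission
  imports Defs
begin

text \<open>The element \<open>\<nu> = e\<^sub>2 - i e\<^sub>1\<close> satisfies \<open>\<nu>\<^sup>2 = 0\<close>, so every \<open>v\<close> is \<open>p + n \<nu>\<close> with \<open>p\<close> its image under a
  ring homomorphism to the complex numbers and \<open>n\<close> its second coefficient; in particular \<open>\<zeta> = z + y \<nu>\<close>.
  In these coordinates the integral with density \<open>p + n \<nu>\<close> is \<open>S p + (G p + S n) \<nu>\<close>, where \<open>S\<close> is the
  classical Schwarz integral of the unit disk and
  \<open>G f (z) = i (c\<^sub>1 cnj z + c\<^sub>2) - i (1 - |z|\<^sup>2) E f (z)\<close> with the Fourier coefficients \<open>c\<^sub>k\<close> of \<open>f\<close> and
  \<open>E f\<close> holomorphic. For a Dini density, dominated convergence in polar coordinates shows that \<open>S f\<close> has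
  limits on the circle, with real part \<open>f\<close> if \<open>f\<close> is real, and that \<open>(1 - |z|\<^sup>2) E f\<close> tends to 0. Hence
  the boundary conditions prescribe the real parts of two holomorphic functions of the disk, which are thus
  known up to imaginary constants in terms of \<open>c\<^sub>1\<close> and \<open>c\<^sub>2\<close>. They determine \<open>S p\<close>, whose Taylor coefficients
  are in turn multiples of the Fourier coefficients \<open>c\<^sub>k\<close> of \<open>p\<close>.
  Comparing them gives \<open>2 Re c\<^sub>1 = \<kappa>\<^sub>1\<close> and \<open>c\<^sub>2 = \<kappa>\<^sub>2\<close>, where \<open>\<kappa>\<^sub>k\<close> are the Fourier coefficients of
  \<open>u\<^sub>1 + i u\<^sub>3\<close>: the solvability condition is that \<open>\<kappa>\<^sub>1\<close> is real, and \<open>Im c\<^sub>1\<close> is free.\<close>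

section \<open>Cauchy integrals over the unit circle\<close>

text \<open>For continuous \<open>f\<close> and positive \<open>k\<close> this is the derivative of
  order k-1 of the Cauchy integral of \<open>f\<close>, divided by (k-1)!. At 0 it is the Fourier
  coefficient of index k-1, so \<open>c\<^sub>1\<close> and \<open>c\<^sub>2\<close> above are
  \<open>cauchy 2 f 0\<close> and \<open>cauchy 3 f 0\<close>.\<close>

definition cauchy :: "nat \<Rightarrow> (complex \<Rightarrow> complex) \<Rightarrow> complex \<Rightarrow> complex"
  where "cauchy k f z = contour_integral (circlepath 0 1) (\<lambda>t. f t / (t - z) ^ k) / (2 * of_real pi * \<i>)"

lemma has_contour_integral_cauchy:
  assumes "continuous_on (sphere 0 1) f" "norm z < 1"
  shows "((\<lambda>t. f t / (t - z) ^ k) has_contour_integral 2 * of_real pi * \<i> * cauchy k f z) (circlepath 0 1)"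
proof -
  have "continuous_on (path_image (circlepath 0 1)) (\<lambda>t. f t / (t - z) ^ k)"
    using assms by (auto intro!: continuous_intros)
  then have "(\<lambda>t. f t / (t - z) ^ k) contour_integrable_on circlepath 0 1"
    by (rule contour_integrable_continuous_circlepath)
  then show ?thesis
    by (simp add: cauchy_def has_contour_integral_integral)
qed

lemma cauchy_unique:
  assumes "((\<lambda>t. f t / (t - z) ^ k) has_contour_integral I) (circlepath 0 1)"
  shows "cauchy k f z = I / (2 * of_real pi * \<i>)"
  using contour_integral_unique[OF assms] by (simp add: cauchy_def)

lemma cauchy_add:
  assumes "continuous_on (sphere 0 1) f" "continuous_on (sphere 0 1) g" "norm z < 1"
  shows "cauchy k (\<lambda>t. f t + g t) z = cauchy k f z + cauchy k g z"
proof -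
  have "((\<lambda>t. (f t + g t) / (t - z) ^ k) has_contour_integral
      2 * of_real pi * \<i> * (cauchy k f z + cauchy k g z)) (circlepath 0 1)"
    using has_contour_integral_add[OF has_contour_integral_cauchy[OF assms(1,3), of k]
        has_contour_integral_cauchy[OF assms(2,3), of k]]
    by (simp add: add_divide_distrib ring_distribs)
  from cauchy_unique[OF this] show ?thesis by simp
qed

lemma cauchy_cmult:
  assumes "continuous_on (sphere 0 1) f" "norm z < 1"
  shows "cauchy k (\<lambda>t. c * f t) z = c * cauchy k f z"
proof -
  have "((\<lambda>t. c * f t / (t - z) ^ k) has_contour_integral
      2 * of_real pi * \<i> * (c * cauchy k f z)) (circlepath 0 1)"
    using has_contour_integral_lmul[OF has_contour_integral_cauchy[OF assms, of k], of c]
    by (simp add: mult_ac)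
  from cauchy_unique[OF this] show ?thesis by simp
qed

lemma cauchy_has_field_derivative:
  assumes "continuous_on (sphere 0 1) f" "norm z < 1" "k \<noteq> 0"
  shows "(cauchy k f has_field_derivative of_nat k * cauchy (Suc k) f z) (at z)"
proof -
  have "((\<lambda>z. 2 * of_real pi * \<i> * cauchy k f z) has_field_derivative
     of_nat k * contour_integral (circlepath 0 1) (\<lambda>u. f u / (u - z) ^ Suc k)) (at z)"
    by (rule Cauchy_next_derivative_circlepath(2))
      (use assms has_contour_integral_cauchy in \<open>auto simp: dist_norm\<close>)
  from DERIV_cdivide[OF this, of "2 * of_real pi * \<i>"] show ?thesis
    by (simp add: cauchy_def[abs_def] mult.commute)
qed

lemma cauchy_holomorphic:
  assumes "continuous_on (sphere 0 1) f" "k \<noteq> 0"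
  shows "cauchy k f holomorphic_on ball 0 1"
  using cauchy_has_field_derivative[OF assms(1) _ assms(2)]
  by (fastforce simp: holomorphic_on_open)

text \<open>Cauchy's integral formula, used to evaluate the operators on constants and on the
  identity, the densities behind the affine terms of the solution formula.\<close>

lemma cauchy_of_holomorphic:
  assumes "f holomorphic_on UNIV" "norm z < 1"
  shows "cauchy 1 f z = f z"
proof -
  have "((\<lambda>u. f u / (u - z)) has_contour_integral (2 * of_real pi * \<i> * f z)) (circlepath 0 1)"
    by (rule Cauchy_integral_circlepath)
      (use assms in \<open>auto intro!: holomorphic_on_imp_continuous_on intro: holomorphic_on_subset\<close>)
  then show ?thesis using cauchy_unique[of f z 1] by simp
qed

text \<open>\<open>cauchy_E f z\<close> is \<open>(cauchy 2 f z - cauchy 2 f 0) / z\<close> with the singularity at 0 removed.\<close>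

definition cauchy_E :: "(complex \<Rightarrow> complex) \<Rightarrow> complex \<Rightarrow> complex"
  where "cauchy_E f z = cauchy 1 (\<lambda>t. f t / t\<^sup>2) z + cauchy 2 (\<lambda>t. f t / t) z"

text \<open>Over the common denominator t^2 (t-z)^2 the two Cauchy kernels add up to a single one,
  homogeneous in t and z; \<open>cauchy_E_polar\<close> relies on this homogeneity.\<close>

lemma has_contour_integral_cauchy_E:
  assumes "continuous_on (sphere 0 1) f" "norm z < 1"
  shows "((\<lambda>t. f t * (2 * t - z) / (t\<^sup>2 * (t - z)\<^sup>2)) has_contour_integral
     2 * of_real pi * \<i> * cauchy_E f z) (circlepath 0 1)"
proof -
  have c: "continuous_on (sphere 0 1) (\<lambda>t. f t / t\<^sup>2)" "continuous_on (sphere 0 1) (\<lambda>t. f t / t)"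
    using assms by (auto intro!: continuous_intros)
  have "((\<lambda>t. f t / t\<^sup>2 / (t - z) ^ 1 + f t / t / (t - z) ^ 2) has_contour_integral
     2 * of_real pi * \<i> * cauchy_E f z) (circlepath 0 1)"
    using has_contour_integral_add[OF has_contour_integral_cauchy[OF c(1) assms(2), of 1]
        has_contour_integral_cauchy[OF c(2) assms(2), of 2]]
    by (simp add: cauchy_E_def ring_distribs)
  then show ?thesis
  proof (rule has_contour_integral_eq)
    fix t assume "t \<in> path_image (circlepath (0::complex) 1)"
    then have "t \<noteq> 0" "t - z \<noteq> 0" using assms(2) by auto
    then show "f t / t\<^sup>2 / (t - z) ^ 1 + f t / t / (t - z) ^ 2 = f t * (2 * t - z) / (t\<^sup>2 * (t - z)\<^sup>2)"
      by (simp add: divide_simps) (simp add: algebra_simps power2_eq_square)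
  qed
qed

text \<open>The difference 1/(t-z)^2 - 1/t^2 is z times the kernel (2t-z) / (t^2 (t-z)^2).\<close>

lemma cauchy_E_eq:
  assumes "continuous_on (sphere 0 1) f" "norm z < 1"
  shows "z * cauchy_E f z = cauchy 2 f z - cauchy 2 f 0"
proof -
  have "((\<lambda>t. z * (f t * (2 * t - z) / (t\<^sup>2 * (t - z)\<^sup>2))) has_contour_integral
     z * (2 * of_real pi * \<i> * cauchy_E f z)) (circlepath 0 1)"
    by (rule has_contour_integral_lmul[OF has_contour_integral_cauchy_E[OF assms]])
  then have "((\<lambda>t. f t / (t - z) ^ 2 - f t / (t - 0) ^ 2) has_contour_integral
     z * (2 * of_real pi * \<i> * cauchy_E f z)) (circlepath 0 1)"
  proof (rule has_contour_integral_eq)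
    fix t assume "t \<in> path_image (circlepath (0::complex) 1)"
    then have "t \<noteq> 0" "t - z \<noteq> 0" using assms(2) by auto
    then show "z * (f t * (2 * t - z) / (t\<^sup>2 * (t - z)\<^sup>2)) = f t / (t - z) ^ 2 - f t / (t - 0) ^ 2"
      by (simp add: divide_simps) (simp add: algebra_simps power2_eq_square)
  qed
  moreover have "((\<lambda>t. f t / (t - z) ^ 2 - f t / (t - 0) ^ 2) has_contour_integral
     2 * of_real pi * \<i> * cauchy 2 f z - 2 * of_real pi * \<i> * cauchy 2 f 0) (circlepath 0 1)"
    by (intro has_contour_integral_diff has_contour_integral_cauchy) (use assms in auto)
  ultimately have "z * (2 * of_real pi * \<i> * cauchy_E f z)
      = 2 * of_real pi * \<i> * cauchy 2 f z - 2 * of_real pi * \<i> * cauchy 2 f 0"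
    by (rule has_contour_integral_unique)
  then have "(2 * of_real pi * \<i>) * (z * cauchy_E f z) = (2 * of_real pi * \<i>) * (cauchy 2 f z - cauchy 2 f 0)"
    by (simp add: algebra_simps)
  then show ?thesis by simp
qed

lemma cauchy_E_holomorphic:
  assumes "continuous_on (sphere 0 1) f"
  shows "cauchy_E f holomorphic_on ball 0 1"
proof -
  have "continuous_on (sphere 0 1) (\<lambda>t. f t / t\<^sup>2)" "continuous_on (sphere 0 1) (\<lambda>t. f t / t)"
    using assms by (auto intro!: continuous_intros)
  then show ?thesis
    unfolding cauchy_E_def[abs_def] by (intro holomorphic_intros cauchy_holomorphic) auto
qed

text \<open>Off the origin this follows from \<open>cauchy_E_eq\<close> after division by z; at the
  origin continuity supplies the value.\<close>

lemma cauchy_E_eq_0: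
  assumes f: "continuous_on (sphere 0 1) f"
    and c: "\<And>z. norm z < 1 \<Longrightarrow> cauchy 2 f z = c"
    and z: "norm z < 1"
  shows "cauchy_E f z = 0"
proof -
  have nz: "cauchy_E f w = 0" if "norm w < 1" "w \<noteq> 0" for w
    using cauchy_E_eq[OF f that(1)] c[of w] c[of 0] that by simp
  have "isCont (cauchy_E f) 0"
    using cauchy_E_holomorphic[OF f] holomorphic_on_imp_continuous_on continuous_on_interior[of "ball 0 1"]
    by fastforce
  then have "(cauchy_E f \<longlongrightarrow> cauchy_E f 0) (at 0)" by (simp add: isCont_def)
  moreover have "(cauchy_E f \<longlongrightarrow> 0) (at 0)"
  proof (rule tendsto_eventually)
    have "\<forall>\<^sub>F x in at (0::complex). x \<in> ball 0 1"
      by (intro eventually_at_in_open') auto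
    moreover have "\<forall>\<^sub>F x in at (0::complex). x \<noteq> 0"
      by (simp add: eventually_neq_at_within)
    ultimately show "\<forall>\<^sub>F x in at 0. cauchy_E f x = 0"
      by eventually_elim (auto intro: nz)
  qed
  ultimately have "cauchy_E f 0 = 0" using tendsto_unique[OF at_neq_bot] by blast
  then show ?thesis using nz z by metis
qed

text \<open>The classical Schwarz integral, since 2/(t-z) - 1/t = (t+z) / (t (t-z)).\<close>

definition cauchy_S :: "(complex \<Rightarrow> complex) \<Rightarrow> complex \<Rightarrow> complex"
  where "cauchy_S f z = 2 * cauchy 1 f z - cauchy 1 f 0"

definition cauchy_G :: "(complex \<Rightarrow> complex) \<Rightarrow> complex \<Rightarrow> complex"
  where "cauchy_G f z = \<i> * (cauchy 2 f 0 * cnj z + cauchy 3 f 0) - \<i> * (1 - of_real ((norm z)\<^sup>2)) * cauchy_E f z"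

text \<open>The definition displays the boundary limit; this form displays monogenicity, with Im z
  times the derivative of \<open>cauchy_S f\<close> plus a holomorphic function. Substitute cnj z =
  z - 2 i Im z and collect the terms with Im z by \<open>cauchy_E_eq\<close>.\<close>

lemma cauchy_G_eq:
  assumes "continuous_on (sphere 0 1) f" "norm z < 1"
  shows "cauchy_G f z = 2 * of_real (Im z) * cauchy 2 f z
    + \<i> * (cauchy 2 f 0 * z + cauchy 3 f 0 - cauchy_E f z + z\<^sup>2 * cauchy_E f z)"
proof -
  define y where "y = complex_of_real (Im z)"
  have 1: "cnj z = z - 2 * \<i> * y" by (simp add: y_def complex_eq_iff)
  have 2: "complex_of_real ((norm z)\<^sup>2) = z * (z - 2 * \<i> * y)"
    using complex_norm_square[of z] 1 by simp
  have 3: "cauchy 2 f z = z * cauchy_E f z + cauchy 2 f 0"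
    using cauchy_E_eq[OF assms] by simp
  have i: "\<i> * \<i> = -1" by simp
  show ?thesis unfolding cauchy_G_def 2 unfolding 1 3 y_def[symmetric]
    using i by algebra
qed

lemma cauchy_S_holomorphic:
  assumes "continuous_on (sphere 0 1) f"
  shows "cauchy_S f holomorphic_on ball 0 1"
  unfolding cauchy_S_def[abs_def] by (intro holomorphic_intros cauchy_holomorphic assms) auto

section \<open>Linearity of the integral operators\<close>

lemma cauchy_E_add:
  assumes "continuous_on (sphere 0 1) f" "continuous_on (sphere 0 1) g" "norm z < 1"
  shows "cauchy_E (\<lambda>t. f t + g t) z = cauchy_E f z + cauchy_E g z"
proof -
  have c: "continuous_on (sphere 0 1) (\<lambda>t. h t / t\<^sup>2)" "continuous_on (sphere 0 1) (\<lambda>t. h t / t)"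
    if "continuous_on (sphere 0 1) h" for h :: "complex \<Rightarrow> complex"
    using that by (auto intro!: continuous_intros)
  show ?thesis
    unfolding cauchy_E_def add_divide_distrib using assms c by (simp add: cauchy_add)
qed

lemma cauchy_E_cmult:
  assumes "continuous_on (sphere 0 1) f" "norm z < 1"
  shows "cauchy_E (\<lambda>t. c * f t) z = c * cauchy_E f z"
proof -
  have c: "continuous_on (sphere 0 1) (\<lambda>t. f t / t\<^sup>2)" "continuous_on (sphere 0 1) (\<lambda>t. f t / t)"
    using assms by (auto intro!: continuous_intros)
  show ?thesis
    unfolding cauchy_E_def times_divide_eq_right[symmetric] using assms c
    by (simp add: cauchy_cmult ring_distribs del: times_divide_eq_right)
qed

lemma cauchy_S_add:
  assumes "continuous_on (sphere 0 1) f" "continuous_on (sphere 0 1) g" "norm z < 1"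
  shows "cauchy_S (\<lambda>t. f t + g t) z = cauchy_S f z + cauchy_S g z"
  using assms by (simp add: cauchy_S_def cauchy_add)

lemma cauchy_S_cmult:
  assumes "continuous_on (sphere 0 1) f" "norm z < 1"
  shows "cauchy_S (\<lambda>t. c * f t) z = c * cauchy_S f z"
  using assms by (simp add: cauchy_S_def cauchy_cmult algebra_simps)

lemma cauchy_G_add:
  assumes "continuous_on (sphere 0 1) f" "continuous_on (sphere 0 1) g" "norm z < 1"
  shows "cauchy_G (\<lambda>t. f t + g t) z = cauchy_G f z + cauchy_G g z"
  using assms by (simp add: cauchy_G_def cauchy_add cauchy_E_add algebra_simps)

lemma cauchy_G_cmult:
  assumes "continuous_on (sphere 0 1) f" "norm z < 1"
  shows "cauchy_G (\<lambda>t. c * f t) z = c * cauchy_G f z"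
  using assms by (simp add: cauchy_G_def cauchy_cmult cauchy_E_cmult algebra_simps)

text \<open>Reads Fourier coefficients of the density off the Taylor coefficients of its Schwarz
  integral. Differentiating \<open>cauchy 1 f\<close>, which is affine as well, shows that
  \<open>cauchy 2 f\<close> is constant; its derivative at 0 is twice
  \<open>cauchy 3 f 0\<close>.\<close>

lemma affine_cauchy_S:
  assumes f: "continuous_on (sphere 0 1) f"
    and aff: "\<And>z. norm z < 1 \<Longrightarrow> cauchy_S f z = 2 * c * z + d"
  shows "cauchy 2 f 0 = c" "cauchy 3 f 0 = 0" "\<And>z. norm z < 1 \<Longrightarrow> cauchy_E f z = 0"
proof -
  have c2: "cauchy 2 f z = c" if z: "norm z < 1" for z
  proof -
    \<comment> \<open>This affine function results from solving the definition of
      \<open>cauchy_S\<close> for \<open>cauchy 1 f w\<close>.\<close>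
    have "((\<lambda>w. c * w + (d + cauchy 1 f 0) / 2) has_field_derivative c) (at z)"
      by (auto intro!: derivative_eq_intros)
    then have "(cauchy 1 f has_field_derivative c) (at z)"
    proof (rule has_field_derivative_transform_within_open[of _ _ _ "ball 0 1"])
      fix w :: complex assume "w \<in> ball 0 1"
      then show "c * w + (d + cauchy 1 f 0) / 2 = cauchy 1 f w"
        using aff[of w] by (simp add: cauchy_S_def field_simps)
    qed (use z in auto)
    moreover have "(cauchy 1 f has_field_derivative cauchy 2 f z) (at z)"
      using cauchy_has_field_derivative[OF f z, of 1] by (simp add: numeral_2_eq_2)
    ultimately show ?thesis using DERIV_unique by blast
  qed
  show "cauchy 2 f 0 = c" using c2 by simp
  have "((\<lambda>w. c) has_field_derivative 0) (at 0)" by simp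
  then have "(cauchy 2 f has_field_derivative 0) (at 0)"
    by (rule has_field_derivative_transform_within_open[of _ _ _ "ball 0 1"]) (auto simp: c2)
  moreover have "(cauchy 2 f has_field_derivative 2 * cauchy 3 f 0) (at 0)"
    using cauchy_has_field_derivative[OF f, of 0 2] by (simp add: numeral_3_eq_3 numeral_2_eq_2)
  ultimately show "cauchy 3 f 0 = 0" using DERIV_unique by fastforce
  show "cauchy_E f z = 0" if "norm z < 1" for z
    using cauchy_E_eq_0[OF f c2 that] by blast
qed

section \<open>Boundary behaviour\<close>

lemma integral_cis_rotate:
  fixes g :: "complex \<Rightarrow> complex"
  assumes g: "continuous_on (sphere 0 1) g" and s: "norm s = 1"
  shows "integral {0..2*pi} (\<lambda>\<theta>. g (cis \<theta>)) = integral {-pi..pi} (\<lambda>\<theta>. g (s * cis \<theta>))"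
proof -
  have int: "(\<lambda>\<theta>. g (cis (\<theta> + c))) integrable_on {a..b}" for a b c
    by (intro integrable_continuous_real continuous_on_compose2[OF g]) (auto intro!: continuous_intros)
  have int0: "(\<lambda>\<theta>. g (cis \<theta>)) integrable_on {a..b}" for a b
    using int[of 0] by simp
  have shift: "integral {a..b} (\<lambda>\<theta>. g (cis (\<theta> + c))) = integral {a+c..b+c} (\<lambda>\<theta>. g (cis \<theta>))" for a b c
  proof -
    have "continuous_on {a+c..b+c} (\<lambda>\<theta>. g (cis \<theta>))"
      by (intro continuous_on_compose2[OF g]) (auto intro!: continuous_intros)
    from integral_shift_real_ivl[of "a+c" c "b+c" "\<lambda>\<theta>. g (cis \<theta>)"] show ?thesis
      by (simp add: add.commute)
  qed
  \<comment> \<open>Starting from the angle of -s, the interval [-pi, pi] is shifted by a + pi onto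
    [a, a + 2 pi] with a in [0, 2 pi), so a single cut at 2 pi suffices.\<close>
  define a where "a = Arg2pi (- s)"
  have a: "0 \<le> a" "a < 2 * pi" "- s = cis a"
    using Arg2pi_ge_0[of "-s"] Arg2pi_lt_2pi[of "-s"] Arg2pi_eq[of "-s"] s by (auto simp: a_def cis_conv_exp)
  have s': "s = cis (a + pi)"
    using arg_cong[OF a(3), of uminus] by (simp only: cis_mult[symmetric] cis_pi) simp
  have "integral {-pi..pi} (\<lambda>\<theta>. g (s * cis \<theta>)) = integral {-pi..pi} (\<lambda>\<theta>. g (cis (\<theta> + (a + pi))))"
    unfolding s' cis_mult by (simp add: add.commute)
  also have "\<dots> = integral {a..a+2*pi} (\<lambda>\<theta>. g (cis \<theta>))"
    unfolding shift by (simp add: algebra_simps)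
  also have "\<dots> = integral {a..2*pi} (\<lambda>\<theta>. g (cis \<theta>)) + integral {2*pi..a+2*pi} (\<lambda>\<theta>. g (cis \<theta>))"
    by (rule Henstock_Kurzweil_Integration.integral_combine[symmetric]) (use a int0 in auto)
  also have "integral {2*pi..a+2*pi} (\<lambda>\<theta>. g (cis \<theta>)) = integral {0..a} (\<lambda>\<theta>. g (cis \<theta>))"
    using shift[of 0 a "2*pi"] by (simp add: cis_mult[symmetric])
  also have "integral {a..2*pi} (\<lambda>\<theta>. g (cis \<theta>)) + integral {0..a} (\<lambda>\<theta>. g (cis \<theta>))
     = integral {0..2*pi} (\<lambda>\<theta>. g (cis \<theta>))"
    using Henstock_Kurzweil_Integration.integral_combine[of 0 a "2*pi" "\<lambda>\<theta>. g (cis \<theta>)"] a int0 by (simp add: add.commute)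
  finally show ?thesis by simp
qed

text \<open>Here dt = i t d\<theta>. The rotation by s moves the direction of z = r s to angle 0, so
  that the kernels will depend on the radius r alone.\<close>

lemma has_contour_integral_circle_rotate:
  assumes "(f has_contour_integral I) (circlepath 0 1)" "continuous_on (sphere 0 1) f" "norm s = 1"
  shows "integral {-pi..pi} (\<lambda>\<theta>. f (s * cis \<theta>) * (s * cis \<theta>)) = I / \<i>"
proof -
  have "((\<lambda>t. f (0 + of_real 1 * cis t) * of_real 1 * \<i> * cis t) has_integral I) {0..2*pi}"
    using assms(1) has_contour_integral_part_circlepath_iff[of 0 "2*pi" f I 0 1]
    by (simp add: circlepath_def)
  then have "((\<lambda>t. \<i> * (f (cis t) * cis t)) has_integral I) {0..2*pi}"
    by (simp add: mult_ac)
  from has_integral_mult_right[OF this, of "1/\<i>"]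
  have "((\<lambda>t. f (cis t) * cis t) has_integral I / \<i>) {0..2*pi}"
    by simp
  then have "integral {0..2*pi} (\<lambda>t. f (cis t) * cis t) = I / \<i>"
    by (rule integral_unique)
  moreover have "continuous_on (sphere 0 1) (\<lambda>t. f t * t)"
    using assms(2) by (intro continuous_intros)
  ultimately show ?thesis
    using integral_cis_rotate[of "\<lambda>t. f t * t" s] assms(3) by simp
qed

text \<open>The factor \<open>norm (cis \<theta> - 1)\<close> cancels the singularity of the kernels, so that \<open>h\<close> dominates.\<close>

definition dini_circle :: "(complex \<Rightarrow> complex) \<Rightarrow> bool"
  where "dini_circle f \<longleftrightarrow> continuous_on (sphere 0 1) f \<and>
    (\<exists>h. h integrable_on {-pi..pi} \<and> (\<forall>\<theta>. 0 \<le> h \<theta>) \<and>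
      (\<forall>s \<theta>. norm s = 1 \<longrightarrow> \<theta> \<in> {-pi..pi} \<longrightarrow>
         norm (f (s * cis \<theta>) - f s) \<le> norm (cis \<theta> - 1) * h \<theta>))"

section \<open>Closure properties of the Dini class on the circle\<close>

lemma dini_circle_add:
  assumes "dini_circle f" "dini_circle g"
  shows "dini_circle (\<lambda>t. f t + g t)"
proof -
  obtain h where h: "continuous_on (sphere 0 1) f" "h integrable_on {-pi..pi}" "\<And>\<theta>. 0 \<le> h \<theta>"
      "\<And>s \<theta>. norm s = 1 \<Longrightarrow> \<theta> \<in> {-pi..pi} \<Longrightarrow> norm (f (s * cis \<theta>) - f s) \<le> norm (cis \<theta> - 1) * h \<theta>"
    using assms(1) unfolding dini_circle_def by blast
  obtain k where k: "continuous_on (sphere 0 1) g" "k integrable_on {-pi..pi}" "\<And>\<theta>. 0 \<le> k \<theta>"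
      "\<And>s \<theta>. norm s = 1 \<Longrightarrow> \<theta> \<in> {-pi..pi} \<Longrightarrow> norm (g (s * cis \<theta>) - g s) \<le> norm (cis \<theta> - 1) * k \<theta>"
    using assms(2) unfolding dini_circle_def by blast
  have "norm (f (s * cis \<theta>) + g (s * cis \<theta>) - (f s + g s)) \<le> norm (cis \<theta> - 1) * (h \<theta> + k \<theta>)"
    if "norm s = 1" "\<theta> \<in> {-pi..pi}" for s \<theta>
    using h(4)[OF that] k(4)[OF that]
      norm_triangle_ineq[of "f (s * cis \<theta>) - f s" "g (s * cis \<theta>) - g s"]
    by (simp add: algebra_simps)
  then show ?thesis unfolding dini_circle_def
    using h(1-3) k(1-3) by (auto intro!: continuous_intros exI[of _ "\<lambda>\<theta>. h \<theta> + k \<theta>"] integrable_add)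
qed

lemma dini_circle_cmult:
  assumes "dini_circle f"
  shows "dini_circle (\<lambda>t. c * f t)"
proof -
  obtain h where h: "continuous_on (sphere 0 1) f" "h integrable_on {-pi..pi}" "\<And>\<theta>. 0 \<le> h \<theta>"
      "\<And>s \<theta>. norm s = 1 \<Longrightarrow> \<theta> \<in> {-pi..pi} \<Longrightarrow> norm (f (s * cis \<theta>) - f s) \<le> norm (cis \<theta> - 1) * h \<theta>"
    using assms(1) unfolding dini_circle_def by blast
  have "norm (c * f (s * cis \<theta>) - c * f s) \<le> norm (cis \<theta> - 1) * (norm c * h \<theta>)"
    if "norm s = 1" "\<theta> \<in> {-pi..pi}" for s \<theta>
    using mult_left_mono[OF h(4)[OF that], of "norm c"]
    by (simp add: norm_mult[symmetric] right_diff_distrib mult_ac)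
  then show ?thesis unfolding dini_circle_def
    using h(1-3) by (auto intro!: continuous_intros exI[of _ "\<lambda>\<theta>. norm c * h \<theta>"] integrable_on_mult_right)
qed

text \<open>Both are triangle inequalities, the first through the detour of length 1 - r. They
  compare the kernel singularity at radius r with the one at radius 1, uniformly in r.\<close>

lemma norm_cis_minus_of_real:
  assumes "0 \<le> r" "r \<le> 1"
  shows "norm (cis \<theta> - 1) \<le> 2 * norm (cis \<theta> - of_real r)" "1 - r \<le> norm (cis \<theta> - of_real r)"
proof -
  show 1: "1 - r \<le> norm (cis \<theta> - of_real r)"
    using norm_triangle_ineq2[of "cis \<theta>" "of_real r"] assms by simp
  have "norm (cis \<theta> - 1) \<le> norm (cis \<theta> - of_real r) + norm (of_real r - (1::complex))"
    using norm_triangle_ineq[of "cis \<theta> - of_real r" "of_real r - (1::complex)"] by simp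
  also have "norm (of_real r - (1::complex)) = 1 - r"
    using norm_of_real[of "r - 1", where 'a = complex] assms by simp
  finally show "norm (cis \<theta> - 1) \<le> 2 * norm (cis \<theta> - of_real r)"
    using 1 by simp
qed

text \<open>In polar coordinates the Dini bound on \<open>f (s * cis \<theta>) - f s\<close> absorbs
  the kernel singularity and leaves the majorant \<open>2 * K * h\<close>, independent of radius and
  direction. As both vary along the sequence, the approach to z is unrestricted. The parameters
  \<open>c\<close>, \<open>d\<close>, \<open>k\<close> cover the Schwarz integral and
  \<open>cauchy_E\<close> at once.\<close>

lemma dini_kernel_limit:
  fixes k :: "real \<Rightarrow> complex \<Rightarrow> complex"
  assumes f: "dini_circle f"
    and k: "\<And>r t. 0 \<le> r \<Longrightarrow> r \<le> 1 \<Longrightarrow> norm t = 1 \<Longrightarrow> norm (k r t) \<le> K / norm (t - of_real r)"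
    and k_cont: "\<And>r. 0 \<le> r \<Longrightarrow> r < 1 \<Longrightarrow> continuous_on (sphere 0 1) (k r)"
    and k_lim: "\<And>t. norm t = 1 \<Longrightarrow> t \<noteq> 1 \<Longrightarrow> ((\<lambda>r. k r t) \<longlongrightarrow> k 1 t) (at 1)"
    and F: "\<And>s r. norm s = 1 \<Longrightarrow> 0 \<le> r \<Longrightarrow> r < 1 \<Longrightarrow>
      F (of_real r * s) = c s + d s * integral {-pi..pi} (\<lambda>\<theta>. (f (s * cis \<theta>) - f s) * k r (cis \<theta>))"
    and cont: "continuous_on (sphere 0 1) c" "continuous_on (sphere 0 1) d"
    and z: "norm z = 1"
  shows "(F \<longlongrightarrow> c z + d z * integral {-pi..pi} (\<lambda>\<theta>. (f (z * cis \<theta>) - f z) * k 1 (cis \<theta>)))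
    (at z within ball 0 1)"
  unfolding tendsto_at_iff_sequentially
proof (intro allI impI)
  fix X :: "nat \<Rightarrow> complex"
  assume X: "\<forall>i. X i \<in> ball 0 1 - {z}" "X \<longlonglongrightarrow> z"
  obtain h where h: "continuous_on (sphere 0 1) f" "h integrable_on {-pi..pi}" "\<And>\<theta>. 0 \<le> h \<theta>"
      "\<And>s \<theta>. norm s = 1 \<Longrightarrow> \<theta> \<in> {-pi..pi} \<Longrightarrow> norm (f (s * cis \<theta>) - f s) \<le> norm (cis \<theta> - 1) * h \<theta>"
    using f unfolding dini_circle_def by blast
  define r where "r = (\<lambda>n. norm (X n))"
  \<comment> \<open>At the origin any unit vector would serve; eventually \<open>X n\<close> is
    nonzero because its limit z is.\<close>
  define s where "s = (\<lambda>n. if X n = 0 then 1 else sgn (X n))"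
  have Xrs: "X n = of_real (r n) * s n" for n
    by (simp add: r_def s_def sgn_eq)
  have r: "0 \<le> r n" "r n < 1" for n using X(1) by (auto simp: r_def)
  have s: "norm (s n) = 1" for n by (simp add: s_def norm_sgn)
  have rlim: "r \<longlonglongrightarrow> 1" using tendsto_norm[OF X(2)] z by (simp add: r_def)
  have slim: "s \<longlonglongrightarrow> z"
  proof -
    have "z \<noteq> 0" using z by auto
    have "(\<lambda>n. sgn (X n)) \<longlonglongrightarrow> sgn z" by (rule tendsto_sgn) (use X \<open>z \<noteq> 0\<close> in auto)
    moreover have "sgn z = z" using z by (simp add: sgn_eq)
    moreover have "\<forall>\<^sub>F n in sequentially. X n \<noteq> 0"
      using tendsto_imp_eventually_ne[OF X(2)] \<open>z \<noteq> 0\<close> by blast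
    then have "\<forall>\<^sub>F n in sequentially. sgn (X n) = s n"
      by eventually_elim (simp add: s_def)
    ultimately show ?thesis using tendsto_cong[of "\<lambda>n. sgn (X n)" s] by metis
  qed
  have slim': "(\<lambda>n. g (s n)) \<longlonglongrightarrow> g z" if "continuous_on (sphere 0 1) g" for g :: "complex \<Rightarrow> complex"
    by (rule continuous_on_tendsto_compose[OF that slim]) (use z s in auto)
  have "(\<lambda>n. integral {-pi..pi} (\<lambda>\<theta>. (f (s n * cis \<theta>) - f (s n)) * k (r n) (cis \<theta>)))
     \<longlonglongrightarrow> integral {-pi..pi} (\<lambda>\<theta>. (f (z * cis \<theta>) - f z) * k 1 (cis \<theta>))"
  proof (rule dominated_convergence(2))
    show "(\<lambda>\<theta>. (f (s n * cis \<theta>) - f (s n)) * k (r n) (cis \<theta>)) integrable_on {- pi..pi}" for n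
      by (intro integrable_continuous_real continuous_intros continuous_on_compose2[OF h(1)]
          continuous_on_compose2[OF k_cont[OF r]]) (auto simp: norm_mult s)
    show "(\<lambda>\<theta>. 2 * K * h \<theta>) integrable_on {-pi..pi}"
      by (rule integrable_on_mult_right[OF h(2)])
    show "norm ((f (s n * cis \<theta>) - f (s n)) * k (r n) (cis \<theta>)) \<le> 2 * K * h \<theta>"
      if \<theta>: "\<theta> \<in> {-pi..pi}" for n \<theta>
    proof -
      have K: "norm (k (r n) (cis \<theta>)) \<le> K / norm (cis \<theta> - of_real (r n))"
        using k[of "r n" "cis \<theta>"] r[of n] by auto
      have p: "norm (cis \<theta> - of_real (r n)) > 0"
        using norm_cis_minus_of_real(2)[of "r n" \<theta>] r[of n] by linarith
      have f1: "norm (f (s n * cis \<theta>) - f (s n)) \<le> norm (cis \<theta> - 1) * h \<theta>"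
        using h(4)[OF s \<theta>] .
      have "norm (f (s n * cis \<theta>) - f (s n)) \<le> 2 * norm (cis \<theta> - of_real (r n)) * h \<theta>"
        using f1 mult_right_mono[OF norm_cis_minus_of_real(1)[of "r n" \<theta>] h(3)] r[of n]
        by (meson less_eq_real_def order_trans)
      then have "norm (f (s n * cis \<theta>) - f (s n)) * norm (k (r n) (cis \<theta>))
         \<le> (2 * norm (cis \<theta> - of_real (r n)) * h \<theta>) * (K / norm (cis \<theta> - of_real (r n)))"
        using K h(3) by (intro mult_mono) auto
      also have "\<dots> = 2 * K * h \<theta>" using p by simp
      finally show ?thesis by (simp add: norm_mult)
    qed
    show "(\<lambda>n. (f (s n * cis \<theta>) - f (s n)) * k (r n) (cis \<theta>)) \<longlonglongrightarrow> (f (z * cis \<theta>) - f z) * k 1 (cis \<theta>)"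
      for \<theta>
    \<comment> \<open>Here the kernel may be singular at r = 1, but its factor vanishes because
      \<open>s * cis \<theta> = s\<close>.\<close>
    proof (cases "cis \<theta> = 1")
      case True then show ?thesis by simp
    next
      case False
      have "(\<lambda>n. k (r n) (cis \<theta>)) \<longlonglongrightarrow> k 1 (cis \<theta>)"
        by (rule filterlim_compose[OF k_lim[OF norm_cis False]])
          (use rlim r in \<open>auto simp: filterlim_at less_le\<close>)
      moreover have "(\<lambda>n. f (s n * cis \<theta>)) \<longlonglongrightarrow> f (z * cis \<theta>)"
        by (rule continuous_on_tendsto_compose[OF h(1) tendsto_mult[OF slim tendsto_const]])
          (use z s in \<open>auto simp: norm_mult\<close>)
      ultimately show ?thesis using slim'[OF h(1)] by (intro tendsto_intros)
    qed
  qed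
  then show "(F \<circ> X) \<longlonglongrightarrow> c z + d z * integral {-pi..pi} (\<lambda>\<theta>. (f (z * cis \<theta>) - f z) * k 1 (cis \<theta>))"
    unfolding o_def Xrs F[OF s r] by (intro tendsto_intros slim' cont)
qed

section \<open>Polar forms and boundary limits of the operators\<close>

lemma cauchy_const:
  assumes "norm z < 1"
  shows "cauchy 1 (\<lambda>t. c) z = c"
  using cauchy_of_holomorphic[of "\<lambda>t. c" z] assms by simp

lemma cauchy_ident:
  assumes "norm z < 1"
  shows "cauchy 1 (\<lambda>t. t) z = z"
  using cauchy_of_holomorphic[of "\<lambda>t. t" z] assms by simp

lemma cauchy_E_const:
  assumes "norm z < 1"
  shows "cauchy_E (\<lambda>t. c) z = 0"
  using affine_cauchy_S(3)[of "\<lambda>t. c" 0 c z] assms by (simp add: cauchy_S_def cauchy_const[unfolded One_nat_def])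

text \<open>The Schwarz integral reproduces constants, so \<open>f s\<close> may be subtracted
  inside. For t = s cis \<theta> and z = r s the kernel (t+z)/(t-z) has degree 0, and s
  cancels.\<close>

lemma cauchy_S_polar:
  assumes f: "continuous_on (sphere 0 1) f" and s: "norm s = 1" and r: "0 \<le> r" "r < 1"
  shows "cauchy_S f (of_real r * s) = f s + 1 / (2 * of_real pi) *
    integral {-pi..pi} (\<lambda>\<theta>. (f (s * cis \<theta>) - f s) * ((cis \<theta> + of_real r) / (cis \<theta> - of_real r)))"
proof -
  define f0 where "f0 = (\<lambda>t. f t - f s)"
  define z where "z = of_real r * s"
  have z: "norm z < 1" using r s by (simp add: z_def norm_mult)
  have f0: "continuous_on (sphere 0 1) f0" unfolding f0_def by (intro continuous_intros f)
  have "cauchy_S f z = cauchy_S (\<lambda>t. f0 t + f s) z"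
    by (simp add: f0_def)
  also have "\<dots> = f s + cauchy_S f0 z"
    using z f0 by (subst cauchy_S_add) (auto simp: cauchy_S_def cauchy_const[unfolded One_nat_def])
  finally have 1: "cauchy_S f z = f s + cauchy_S f0 z" .
  have nz: "t \<noteq> 0 \<and> t - z \<noteq> 0" if "norm t = 1" for t using z that by auto
  have "((\<lambda>t. 2 * (f0 t / (t - z) ^ 1) - f0 t / (t - 0) ^ 1) has_contour_integral
      2 * (2 * of_real pi * \<i> * cauchy 1 f0 z) - 2 * of_real pi * \<i> * cauchy 1 f0 0) (circlepath 0 1)"
    by (intro has_contour_integral_diff has_contour_integral_lmul has_contour_integral_cauchy f0 z) simp
  moreover have "continuous_on (sphere 0 1) (\<lambda>t. 2 * (f0 t / (t - z) ^ 1) - f0 t / (t - 0) ^ 1)"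
    using nz by (intro continuous_intros f0) auto
  ultimately have "integral {-pi..pi} (\<lambda>\<theta>. (2 * (f0 (s * cis \<theta>) / (s * cis \<theta> - z) ^ 1) -
        f0 (s * cis \<theta>) / (s * cis \<theta> - 0) ^ 1) * (s * cis \<theta>)) =
      (2 * (2 * of_real pi * \<i> * cauchy 1 f0 z) - 2 * of_real pi * \<i> * cauchy 1 f0 0) / \<i>"
    by (rule has_contour_integral_circle_rotate) (rule s)
  also have "\<dots> = 2 * of_real pi * cauchy_S f0 z"
    by (simp add: cauchy_S_def algebra_simps)
  also have "integral {-pi..pi} (\<lambda>\<theta>. (2 * (f0 (s * cis \<theta>) / (s * cis \<theta> - z) ^ 1) -
        f0 (s * cis \<theta>) / (s * cis \<theta> - 0) ^ 1) * (s * cis \<theta>)) =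
      integral {-pi..pi} (\<lambda>\<theta>. f0 (s * cis \<theta>) * ((cis \<theta> + of_real r) / (cis \<theta> - of_real r)))"
  proof (rule integral_cong)
    fix \<theta>
    have "s \<noteq> 0" using s by auto
    moreover have "s * cis \<theta> - z \<noteq> 0" using nz[of "s * cis \<theta>"] s by (simp add: norm_mult)
    then have "cis \<theta> - of_real r \<noteq> 0" by (auto simp: z_def)
    moreover have "s * cis \<theta> - z = s * (cis \<theta> - of_real r)" by (simp add: z_def algebra_simps)
    ultimately show "(2 * (f0 (s * cis \<theta>) / (s * cis \<theta> - z) ^ 1) -
        f0 (s * cis \<theta>) / (s * cis \<theta> - 0) ^ 1) * (s * cis \<theta>) =
        f0 (s * cis \<theta>) * ((cis \<theta> + of_real r) / (cis \<theta> - of_real r))"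
      by (simp add: divide_simps) (simp add: algebra_simps)
  qed
  finally show ?thesis unfolding z_def[symmetric] 1 f0_def by (simp add: field_simps)
qed

text \<open>\<open>cauchy_E\<close> annihilates constants, so again \<open>f s\<close> may be
  subtracted. The kernel times t has degree -2, whence 1/s^2; the factor 1 - r^2 joins the kernel to
  offset one power of its singularity. The summand \<open>0 +\<close> fits the shape required by
  \<open>dini_kernel_limit\<close>.\<close>

lemma cauchy_E_polar:
  assumes f: "continuous_on (sphere 0 1) f" and s: "norm s = 1" and r: "0 \<le> r" "r < 1"
  shows "(1 - of_real ((norm (of_real r * s))\<^sup>2)) * cauchy_E f (of_real r * s) = 0 + 1 / (2 * of_real pi * s\<^sup>2) *
    integral {-pi..pi} (\<lambda>\<theta>. (f (s * cis \<theta>) - f s) *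
      ((1 - (of_real r)\<^sup>2) * (2 * cis \<theta> - of_real r) / (cis \<theta> * (cis \<theta> - of_real r)\<^sup>2)))"
proof -
  define f0 where "f0 = (\<lambda>t. f t - f s)"
  define z where "z = of_real r * s"
  have z: "norm z < 1" using r s by (simp add: z_def norm_mult)
  have f0: "continuous_on (sphere 0 1) f0" unfolding f0_def by (intro continuous_intros f)
  have "cauchy_E f z = cauchy_E (\<lambda>t. f0 t + f s) z"
    by (simp add: f0_def)
  also have "\<dots> = cauchy_E f0 z"
    using z f0 by (subst cauchy_E_add) (auto simp: cauchy_E_const)
  finally have 1: "cauchy_E f z = cauchy_E f0 z" .
  have nz: "t \<noteq> 0 \<and> t - z \<noteq> 0" if "norm t = 1" for t using z that by auto
  have "((\<lambda>t. f0 t * (2 * t - z) / (t\<^sup>2 * (t - z)\<^sup>2)) has_contour_integral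
      2 * of_real pi * \<i> * cauchy_E f0 z) (circlepath 0 1)"
    by (rule has_contour_integral_cauchy_E[OF f0 z])
  moreover have "continuous_on (sphere 0 1) (\<lambda>t. f0 t * (2 * t - z) / (t\<^sup>2 * (t - z)\<^sup>2))"
    using nz by (intro continuous_intros f0) auto
  ultimately have "integral {-pi..pi} (\<lambda>\<theta>. f0 (s * cis \<theta>) * (2 * (s * cis \<theta>) - z) /
      ((s * cis \<theta>)\<^sup>2 * (s * cis \<theta> - z)\<^sup>2) * (s * cis \<theta>)) = 2 * of_real pi * \<i> * cauchy_E f0 z / \<i>"
    by (rule has_contour_integral_circle_rotate) (rule s)
  then have 2: "2 * of_real pi * cauchy_E f0 z = integral {-pi..pi} (\<lambda>\<theta>. f0 (s * cis \<theta>) * (2 * (s * cis \<theta>) - z) /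
      ((s * cis \<theta>)\<^sup>2 * (s * cis \<theta> - z)\<^sup>2) * (s * cis \<theta>))"
    by simp
  have "s\<^sup>2 * (1 - (of_real r)\<^sup>2) * (2 * of_real pi * cauchy_E f0 z) =
    integral {-pi..pi} (\<lambda>\<theta>. s\<^sup>2 * (1 - (of_real r)\<^sup>2) * (f0 (s * cis \<theta>) * (2 * (s * cis \<theta>) - z) /
      ((s * cis \<theta>)\<^sup>2 * (s * cis \<theta> - z)\<^sup>2) * (s * cis \<theta>)))"
    unfolding 2 by (rule integral_mult_right[symmetric])
  also have "\<dots> = integral {-pi..pi} (\<lambda>\<theta>. f0 (s * cis \<theta>) *
      ((1 - (of_real r)\<^sup>2) * (2 * cis \<theta> - of_real r) / (cis \<theta> * (cis \<theta> - of_real r)\<^sup>2)))"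
  proof (rule integral_cong)
    fix \<theta>
    have "s \<noteq> 0" using s by auto
    moreover have "s * cis \<theta> - z \<noteq> 0" using nz[of "s * cis \<theta>"] s by (simp add: norm_mult)
    then have "cis \<theta> - of_real r \<noteq> 0" by (auto simp: z_def)
    moreover have "s * cis \<theta> - z = s * (cis \<theta> - of_real r)" "2 * (s * cis \<theta>) - z = s * (2 * cis \<theta> - of_real r)"
      by (simp_all add: z_def algebra_simps)
    moreover have "a \<noteq> 0 \<Longrightarrow> q \<noteq> 0 \<Longrightarrow> s\<^sup>2 * R * (F * (s * p) / ((s * a)\<^sup>2 * (s * q)\<^sup>2) * (s * a)) = F * (R * p / (a * q\<^sup>2))"
      for a q R F p :: complex
      using \<open>s \<noteq> 0\<close> by (simp add: field_simps power2_eq_square)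
    ultimately show "s\<^sup>2 * (1 - (of_real r)\<^sup>2) * (f0 (s * cis \<theta>) * (2 * (s * cis \<theta>) - z) /
      ((s * cis \<theta>)\<^sup>2 * (s * cis \<theta> - z)\<^sup>2) * (s * cis \<theta>)) = f0 (s * cis \<theta>) *
      ((1 - (of_real r)\<^sup>2) * (2 * cis \<theta> - of_real r) / (cis \<theta> * (cis \<theta> - of_real r)\<^sup>2))"
      by (simp only: cis_neq_zero not_False_eq_True)
  qed
  finally have 3: "s\<^sup>2 * (1 - (of_real r)\<^sup>2) * (2 * of_real pi * cauchy_E f0 z) =
     integral {-pi..pi} (\<lambda>\<theta>. (f (s * cis \<theta>) - f s) *
      ((1 - (of_real r)\<^sup>2) * (2 * cis \<theta> - of_real r) / (cis \<theta> * (cis \<theta> - of_real r)\<^sup>2)))"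
    by (simp add: f0_def)
  have "norm z = r" using r s by (simp add: z_def norm_mult)
  moreover have "s \<noteq> 0" using s by auto
  ultimately show ?thesis unfolding z_def[symmetric] 1 3[symmetric] by simp
qed

text \<open>The polar form at r = 1. For a Dini density the numerator controls the singularity at
  angle 0, so no principal value is involved.\<close>

definition cauchy_S_bdry :: "(complex \<Rightarrow> complex) \<Rightarrow> complex \<Rightarrow> complex"
  where "cauchy_S_bdry f z = f z + 1 / (2 * of_real pi) *
    integral {-pi..pi} (\<lambda>\<theta>. (f (z * cis \<theta>) - f z) * ((cis \<theta> + 1) / (cis \<theta> - 1)))"

lemma cauchy_S_tendsto:
  assumes "dini_circle f" "norm z = 1"
  shows "(cauchy_S f \<longlongrightarrow> cauchy_S_bdry f z) (at z within ball 0 1)"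
proof -
  have f: "continuous_on (sphere 0 1) f" using assms(1) by (simp add: dini_circle_def)
  have "(cauchy_S f \<longlongrightarrow> f z + 1 / (2 * of_real pi) * integral {-pi..pi}
      (\<lambda>\<theta>. (f (z * cis \<theta>) - f z) * ((cis \<theta> + of_real 1) / (cis \<theta> - of_real 1)))) (at z within ball 0 1)"
  proof (rule dini_kernel_limit[OF assms(1), where K = 2 and k = "\<lambda>r t. (t + of_real r) / (t - of_real r)"])
    fix r :: real and t :: complex
    assume "0 \<le> r" "r \<le> 1" "norm t = 1"
    then show "norm ((t + of_real r) / (t - of_real r)) \<le> 2 / norm (t - of_real r)"
      using norm_triangle_ineq[of t "of_real r"]
      by (auto simp: norm_divide intro!: divide_right_mono)
  next
    fix r :: real assume "0 \<le> r" "r < 1"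
    then show "continuous_on (sphere 0 1) (\<lambda>t. (t + complex_of_real r) / (t - complex_of_real r))"
      by (auto intro!: continuous_intros)
  next
    fix t :: complex assume "norm t = 1" "t \<noteq> 1"
    then show "((\<lambda>r. (t + of_real r) / (t - of_real r)) \<longlongrightarrow> (t + of_real 1) / (t - of_real 1)) (at 1)"
      by (intro tendsto_intros) auto
  qed (use assms f cauchy_S_polar in \<open>auto intro!: continuous_intros\<close>)
  then show ?thesis by (simp add: cauchy_S_bdry_def)
qed

text \<open>At r = 1 the kernel contains the factor 1 - 1 and vanishes, so the limit is 0. The bound
  6 = 2 * 3 comes from |1 - r^2| \<le> 2 |t - r| and |2t - r| \<le> 3.\<close>

lemma cauchy_E_tendsto:
  assumes "dini_circle f" "norm z = 1"
  shows "((\<lambda>w. (1 - of_real ((norm w)\<^sup>2)) * cauchy_E f w) \<longlongrightarrow> 0) (at z within ball 0 1)"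
proof -
  have f: "continuous_on (sphere 0 1) f" using assms(1) by (simp add: dini_circle_def)
  have "((\<lambda>w. (1 - of_real ((norm w)\<^sup>2)) * cauchy_E f w) \<longlongrightarrow> 0 + 1 / (2 * of_real pi * z\<^sup>2) *
    integral {-pi..pi} (\<lambda>\<theta>. (f (z * cis \<theta>) - f z) *
      ((1 - (of_real 1)\<^sup>2) * (2 * cis \<theta> - of_real 1) / (cis \<theta> * (cis \<theta> - of_real 1)\<^sup>2)))) (at z within ball 0 1)"
  proof (rule dini_kernel_limit[OF assms(1), where K = 6
        and k = "\<lambda>r t. (1 - (of_real r)\<^sup>2) * (2 * t - of_real r) / (t * (t - of_real r)\<^sup>2)"])
    fix r :: real and t :: complex
    assume r: "0 \<le> r" "r \<le> 1" and t: "norm t = 1"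
    obtain \<theta> where \<theta>: "t = cis \<theta>"
      using Arg2pi_eq[of t] t that[of "Arg2pi t"] by (simp add: cis_conv_exp)
    have 1: "1 - r \<le> norm (t - of_real r)"
      using norm_cis_minus_of_real(2)[OF r] \<theta> by simp
    have "norm (1 - (of_real r)\<^sup>2 :: complex) = (1 - r) * (1 + r)"
    proof -
      have "(1 - (of_real r)\<^sup>2 :: complex) = of_real ((1 - r) * (1 + r))"
        by (simp add: power2_eq_square algebra_simps)
      then show ?thesis using r by (simp only: norm_of_real) simp
    qed
    then have 2: "norm (1 - (of_real r)\<^sup>2 :: complex) \<le> norm (t - of_real r) * 2"
      using 1 r by (simp add: mult_mono)
    have 3: "norm (2 * t - of_real r) \<le> 3"
      using norm_triangle_ineq4[of "2 * t" "of_real r"] r t by (simp add: norm_mult)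
    have "norm (1 - (of_real r)\<^sup>2 :: complex) * norm (2 * t - of_real r) \<le> norm (t - of_real r) * 2 * 3"
      by (rule mult_mono[OF 2 3]) auto
    then show "norm ((1 - (of_real r)\<^sup>2) * (2 * t - of_real r) / (t * (t - of_real r)\<^sup>2)) \<le> 6 / norm (t - of_real r)"
      using t by (cases "t = of_real r") (auto simp: norm_divide norm_mult norm_power divide_simps power2_eq_square)
  next
    fix r :: real assume "0 \<le> r" "r < 1"
    then show "continuous_on (sphere 0 1) (\<lambda>t. (1 - (of_real r)\<^sup>2) * (2 * t - of_real r) / (t * (t - of_real r)\<^sup>2) :: complex)"
      by (auto intro!: continuous_intros)
  next
    fix t :: complex assume "norm t = 1" "t \<noteq> 1"
    then show "((\<lambda>r. (1 - (of_real r)\<^sup>2) * (2 * t - of_real r) / (t * (t - of_real r)\<^sup>2)) \<longlongrightarrow>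
       (1 - (of_real 1)\<^sup>2) * (2 * t - of_real 1) / (t * (t - of_real 1)\<^sup>2)) (at 1)"
      by (intro tendsto_intros) auto
  qed (use assms f cauchy_E_polar in \<open>auto intro!: continuous_intros\<close>)
  then show ?thesis by simp
qed

lemma cauchy_G_tendsto:
  assumes "dini_circle f" "norm z = 1"
  shows "(cauchy_G f \<longlongrightarrow> \<i> * (cauchy 2 f 0 * cnj z + cauchy 3 f 0)) (at z within ball 0 1)"
proof -
  have "((\<lambda>w. \<i> * (cauchy 2 f 0 * cnj w + cauchy 3 f 0) - \<i> * ((1 - of_real ((norm w)\<^sup>2)) * cauchy_E f w))
     \<longlongrightarrow> \<i> * (cauchy 2 f 0 * cnj z + cauchy 3 f 0) - \<i> * 0) (at z within ball 0 1)"
    by (intro tendsto_intros cauchy_E_tendsto assms)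
  then show ?thesis by (simp add: cauchy_G_def[abs_def] mult.assoc)
qed

text \<open>The kernel is -i cot(\<theta>/2), which is purely imaginary, and 0 by convention where
  cis \<theta> = 1; against a real density it adds nothing to the real part.\<close>

lemma Re_cauchy_S_bdry:
  assumes f: "dini_circle f" and re: "\<And>t. norm t = 1 \<Longrightarrow> Im (f t) = 0" and z: "norm z = 1"
  shows "Re (cauchy_S_bdry f z) = Re (f z)"
proof -
  have "Re (1 / (2 * complex_of_real pi) *
    integral {-pi..pi} (\<lambda>\<theta>. (f (z * cis \<theta>) - f z) * ((cis \<theta> + 1) / (cis \<theta> - 1)))) = 0"
  \<comment> \<open>Without integrability \<open>integral\<close> is 0 by convention, so both cases
    give a vanishing real part.\<close>
  proof (cases "(\<lambda>\<theta>. (f (z * cis \<theta>) - f z) * ((cis \<theta> + 1) / (cis \<theta> - 1))) integrable_on {-pi..pi}")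
    case True
    have "Re (integral {-pi..pi} (\<lambda>\<theta>. (f (z * cis \<theta>) - f z) * ((cis \<theta> + 1) / (cis \<theta> - 1))))
      = integral {-pi..pi} (\<lambda>\<theta>. Re ((f (z * cis \<theta>) - f z) * ((cis \<theta> + 1) / (cis \<theta> - 1))))"
      using integral_linear[OF True bounded_linear_Re] by (simp add: o_def)
    also have "\<dots> = integral {-pi..pi} (\<lambda>\<theta>. 0)"
    proof (rule integral_cong)
      fix \<theta>
      have "Re ((cis \<theta> + 1) * cnj (cis \<theta> - 1)) = 0"
        using sin_cos_squared_add[of \<theta>] by (simp add: algebra_simps power2_eq_square)
      then have "Re ((cis \<theta> + 1) / (cis \<theta> - 1)) = 0"
        unfolding complex_div_cnj[of "cis \<theta> + 1"] Re_divide_of_real by simp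
      moreover have "Im (f (z * cis \<theta>) - f z) = 0" using re z by (simp add: norm_mult)
      ultimately show "Re ((f (z * cis \<theta>) - f z) * ((cis \<theta> + 1) / (cis \<theta> - 1))) = 0"
        by (simp only: times_complex.sel)
    qed
    finally show ?thesis
      using Re_divide_of_real[of _ "2 * pi"] by simp
  qed (simp add: not_integrable_integral)
  then show ?thesis by (simp only: cauchy_S_bdry_def plus_complex.sel)
qed

section \<open>Continuous extension and uniqueness from boundary real parts\<close>

lemma continuous_on_closureI:
  fixes f :: "'a::metric_space \<Rightarrow> 'b::metric_space"
  assumes "\<And>x. x \<in> closure S \<Longrightarrow> (f \<longlongrightarrow> f x) (at x within S)"
  shows "continuous_on (closure S) f"
  unfolding continuous_on_closure
proof (intro allI impI, elim conjE)
  fix x :: 'a and e :: real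
  assume "x \<in> closure S" and e: "0 < e"
  then have "\<exists>d>0. \<forall>y\<in>S. 0 < dist y x \<and> dist y x < d \<longrightarrow> dist (f y) (f x) < e"
    using assms[of x] by (simp only: Lim_within)
  then obtain d where d: "d > 0" "\<And>y. y \<in> S \<Longrightarrow> 0 < dist y x \<Longrightarrow> dist y x < d \<Longrightarrow> dist (f y) (f x) < e"
    by blast
  have "dist (f y) (f x) < e" if "y \<in> S" "dist y x < d" for y
    using d(2)[OF that(1)] that(2) e by (cases "y = x") auto
  with d(1) show "\<exists>\<delta>>0. \<forall>y. y \<in> S \<and> dist y x < \<delta> \<longrightarrow> dist (f y) (f x) < e"
    by blast
qed

text \<open>The limits extend H continuously to the closed disk, and the maximum principle for Re H
  and -Re H makes the real part equal to k inside. A nonconstant H would have an open image, which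
  contains points with another real part.\<close>

lemma holomorphic_disc_const:
  assumes H: "H holomorphic_on ball 0 1"
    and lim: "\<And>z. norm z = 1 \<Longrightarrow> (H \<longlongrightarrow> l z) (at z within ball 0 1)"
    and re: "\<And>z. norm z = 1 \<Longrightarrow> Re (l z) = k"
  shows "\<exists>c. Re c = k \<and> (\<forall>z\<in>ball 0 1. H z = c)"
proof -
  define K where "K = (\<lambda>z. if norm z < 1 then H z else l z)"
  have K_eq: "((\<lambda>z. if norm z < 1 then H z else l z) \<longlongrightarrow> L) (at x within ball 0 1)
      \<longleftrightarrow> (H \<longlongrightarrow> L) (at x within ball 0 1)" for L x
    by (rule tendsto_cong) (auto simp: eventually_at_filter)
  have contK: "continuous_on (closure (ball 0 1)) K"
  proof (rule continuous_on_closureI)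
    fix x :: complex
    assume "x \<in> closure (ball 0 1)"
    then have x: "norm x \<le> 1" by simp
    show "(K \<longlongrightarrow> K x) (at x within ball 0 1)"
    proof (cases "norm x < 1")
      case True
      then have "(H \<longlongrightarrow> H x) (at x within ball 0 1)"
        using holomorphic_on_imp_continuous_on[OF H] by (simp add: continuous_on)
      then show ?thesis
        using True by (simp add: K_def K_eq)
    next
      case False
      then have "(H \<longlongrightarrow> l x) (at x within ball 0 1)" using lim x by simp
      then show ?thesis
        using False by (simp add: K_def K_eq)
    qed
  qed
  have holK: "K holomorphic_on ball 0 1"
    by (rule holomorphic_transform[OF H]) (simp add: K_def)
  have ReH: "Re (H \<xi>) = k" if "norm \<xi> < 1" for \<xi>
  proof -
    have "Re (K \<xi>) \<le> k"
      by (rule maximum_real_frontier[of K "ball 0 1"]) (use contK holK that re in \<open>auto simp: K_def\<close>)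
    moreover have "Re (- K \<xi>) \<le> - k"
      by (rule maximum_real_frontier[of "\<lambda>z. - K z" "ball 0 1"])
        (use contK holK that re in \<open>auto simp: K_def intro!: continuous_on_minus holomorphic_on_minus\<close>)
    ultimately show ?thesis using that by (simp add: K_def)
  qed
  have "H constant_on ball 0 1"
  proof (rule ccontr)
    assume "\<not> H constant_on ball 0 1"
    then have "open (H ` ball 0 1)"
      by (intro open_mapping_thm[OF H]) auto
    then obtain e where "e > 0" "ball (H 0) e \<subseteq> H ` ball 0 1"
      using open_contains_ball[of "H ` ball 0 1"] by (metis centre_in_ball image_eqI zero_less_one)
    moreover have "H 0 + of_real (e / 2) \<in> ball (H 0) e" using \<open>e > 0\<close> by (simp add: dist_norm)
    ultimately obtain w where "norm w < 1" "H w = H 0 + of_real (e / 2)" by auto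
    then show False using ReH[of w] ReH[of 0] \<open>e > 0\<close> by simp
  qed
  then obtain c where c: "\<And>z. norm z < 1 \<Longrightarrow> H z = c" by (auto simp: constant_on_def)
  show ?thesis using c ReH[of 0] by (intro exI[of _ c]) auto
qed

section \<open>The algebra as dual numbers\<close>

text \<open>The section of \<open>bih_hom\<close> with values in the biharmonic plane: isometric and
  real linear, but not multiplicative.\<close>

definition plane_of :: "complex \<Rightarrow> bih"
  where "plane_of z = plane_pt (Re z) (Im z)"

text \<open>The homomorphism sending \<open>e2\<close> to i, the double root of X^2 = 1 + 2 i X; its
  kernel is spanned by \<nu>.\<close>

definition bih_hom :: "bih \<Rightarrow> complex"
  where "bih_hom v = coeff1 v + \<i> * coeff2 v"

lemma bih_eqI: "bih_hom v = bih_hom w \<Longrightarrow> coeff2 v = coeff2 w \<Longrightarrow> v = w"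
  by (simp add: bih_hom_def bih_eq_iff)

lemma bih_hom_simps [simp]:
  "bih_hom 0 = 0" "bih_hom 1 = 1" "bih_hom e2 = \<i>"
  "bih_hom (v + w) = bih_hom v + bih_hom w" "bih_hom (v - w) = bih_hom v - bih_hom w"
  "bih_hom (r *\<^sub>R v) = of_real r * bih_hom v" "bih_hom (bih_of_complex c) = c"
  by (simp_all add: bih_hom_def zero_bih_def one_bih_def e2_def plus_bih_def minus_bih_def
      scaleR_bih_def bih_of_complex_def scaleR_conv_of_real algebra_simps)

lemma bih_hom_mult [simp]: "bih_hom (v * w) = bih_hom v * bih_hom w"
proof -
  have "\<i> * \<i> = -1" by simp
  then show ?thesis unfolding bih_hom_def times_bih_def bih.sel by algebra
qed

lemma coeff2_simps [simp]:
  "coeff2 0 = 0" "coeff2 1 = 0" "coeff2 e2 = 1"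
  "coeff2 (v + w) = coeff2 v + coeff2 w" "coeff2 (v - w) = coeff2 v - coeff2 w"
  "coeff2 (r *\<^sub>R v) = of_real r * coeff2 v" "coeff2 (bih_of_complex c) = 0"
  by (simp_all add: zero_bih_def one_bih_def e2_def plus_bih_def minus_bih_def
      scaleR_bih_def bih_of_complex_def scaleR_conv_of_real)

text \<open>The Leibniz rule of dual numbers: the product of the two \<nu>-terms drops out as
  \<nu>^2 = 0.\<close>

lemma coeff2_mult [simp]: "coeff2 (v * w) = bih_hom v * coeff2 w + coeff2 v * bih_hom w"
  by (simp add: bih_hom_def times_bih_def algebra_simps)

text \<open>The dual-number inverse 1/(p + n \<nu>) = 1/p - (n/p^2) \<nu>.\<close>

lemma bih_inverse_simps:
  assumes "bih_hom v \<noteq> 0"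
  shows "bih_hom (bih_inverse v) = 1 / bih_hom v" "coeff2 (bih_inverse v) = - coeff2 v / (bih_hom v)\<^sup>2"
proof -
  have v: "v = Bih (coeff1 v) (coeff2 v)" by simp
  have 1: "bih_inverse v = Bih ((coeff1 v + 2 * \<i> * coeff2 v) / (bih_hom v)\<^sup>2) (- coeff2 v / (bih_hom v)\<^sup>2)"
    using Bih_mult_eq_1[of "coeff1 v" "coeff2 v"] assms v
    unfolding bih_hom_def by (intro bih_inverse_unique) simp
  then show "coeff2 (bih_inverse v) = - coeff2 v / (bih_hom v)\<^sup>2" by simp
  have "v * bih_inverse v = 1"
    using Bih_mult_eq_1[of "coeff1 v" "coeff2 v"] assms unfolding 1 bih_hom_def by simp
  from arg_cong[OF this, of bih_hom] show "bih_hom (bih_inverse v) = 1 / bih_hom v"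
    using assms by (simp add: field_simps)
qed

lemma plane_of_Bih: "plane_of z = Bih (of_real (Re z)) (of_real (Im z))"
  by (simp add: plane_of_def plane_pt_def e2_def one_bih_def plus_bih_def scaleR_bih_def scaleR_conv_of_real)

lemma bih_hom_plane_of [simp]: "bih_hom (plane_of z) = z"
  by (simp add: plane_of_Bih bih_hom_def complex_eq_iff)

lemma coeff2_plane_of [simp]: "coeff2 (plane_of z) = of_real (Im z)"
  by (simp add: plane_of_Bih)

lemma linear_plane_of: "linear plane_of"
  by (rule linearI) (simp_all add: plane_of_Bih plus_bih_def scaleR_bih_def scaleR_conv_of_real)

lemma inj_plane_of: "inj plane_of"
  by (metis bih_hom_plane_of injI)

lemma norm_plane_of [simp]: "norm (plane_of z) = norm z"
  by (simp add: plane_of_Bih norm_bih_def cmod_def)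

lemma dist_plane_of [simp]: "dist (plane_of z) (plane_of w) = dist z w"
  by (metis dist_norm linear_diff linear_plane_of norm_plane_of)

lemma bih_plane_eq: "bih_plane = range plane_of"
  unfolding bih_plane_def plane_of_def by (auto simp: image_iff) (metis complex.sel)

lemma disk_eq: "disk = plane_of ` ball 0 1" and cdisk_eq: "cdisk = plane_of ` cball 0 1" and bdisk_eq: "bdisk = plane_of ` sphere 0 1"
  by (auto simp: disk_def cdisk_def bdisk_def bih_plane_eq)

text \<open>The element p + n \<nu> written in the basis, where \<nu> = e2 - i e1.\<close>

definition of_parts :: "complex \<Rightarrow> complex \<Rightarrow> bih"
  where "of_parts p n = Bih (p - \<i> * n) n"

lemma of_parts_simps [simp]: "bih_hom (of_parts p n) = p" "coeff2 (of_parts p n) = n"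
  by (simp_all add: of_parts_def bih_hom_def)

lemma of_parts_eq: "of_parts (bih_hom v) (coeff2 v) = v"
  by (simp add: bih_eqI)

section \<open>Limits, integrals and continuity taken part by part\<close>

lemma bounded_linear_coeff2: "bounded_linear coeff2"
  by (subst linear_conv_bounded_linear[symmetric], rule linearI) (simp_all add: scaleR_conv_of_real)

lemma bounded_linear_bih_hom: "bounded_linear bih_hom"
  by (subst linear_conv_bounded_linear[symmetric], rule linearI) (simp_all add: scaleR_conv_of_real)

lemma bounded_linear_of_parts: "bounded_linear (\<lambda>p. of_parts p 0)" "bounded_linear (\<lambda>n. of_parts 0 n)"
  by (subst linear_conv_bounded_linear[symmetric], rule linearI;
      rule bih_eqI; simp add: scaleR_conv_of_real)+

lemma of_parts_split: "of_parts p n = of_parts p 0 + of_parts 0 n"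
  by (rule bih_eqI) auto

lemma tendsto_of_parts:
  assumes "(p \<longlongrightarrow> a) F" "(n \<longlongrightarrow> b) F"
  shows "((\<lambda>x. of_parts (p x) (n x)) \<longlongrightarrow> of_parts a b) F"
  using tendsto_add[OF bounded_linear.tendsto[OF bounded_linear_of_parts(1) assms(1)]
      bounded_linear.tendsto[OF bounded_linear_of_parts(2) assms(2)]]
  by (simp add: of_parts_split[symmetric])

lemma continuous_on_of_parts:
  assumes "continuous_on S p" "continuous_on S n"
  shows "continuous_on S (\<lambda>x. of_parts (p x) (n x))"
  using assms by (simp add: continuous_on tendsto_of_parts)

lemma tendsto_bih_iff:
  "(\<Phi> \<longlongrightarrow> L) F \<longleftrightarrow> ((\<lambda>x. bih_hom (\<Phi> x)) \<longlongrightarrow> bih_hom L) F \<and> ((\<lambda>x. coeff2 (\<Phi> x)) \<longlongrightarrow> coeff2 L) F"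
proof safe
  assume "((\<lambda>x. bih_hom (\<Phi> x)) \<longlongrightarrow> bih_hom L) F" "((\<lambda>x. coeff2 (\<Phi> x)) \<longlongrightarrow> coeff2 L) F"
  from tendsto_of_parts[OF this] show "(\<Phi> \<longlongrightarrow> L) F" by (simp add: of_parts_eq)
qed (auto intro: bounded_linear.tendsto[OF bounded_linear_bih_hom] bounded_linear.tendsto[OF bounded_linear_coeff2])

lemma has_integral_bih:
  assumes "((\<lambda>x. bih_hom (v x)) has_integral p) S" "((\<lambda>x. coeff2 (v x)) has_integral n) S"
  shows "(v has_integral of_parts p n) S"
proof -
  have "((\<lambda>x. of_parts (bih_hom (v x)) 0 + of_parts 0 (coeff2 (v x))) has_integral of_parts p 0 + of_parts 0 n) S"
    using has_integral_add[OF has_integral_linear[OF assms(1) bounded_linear_of_parts(1)]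
        has_integral_linear[OF assms(2) bounded_linear_of_parts(2)]] by (simp add: o_def)
  then show ?thesis by (simp add: of_parts_split[symmetric] of_parts_eq)
qed

text \<open>\<open>plane_of\<close> preserves distances and is injective, so the two epsilon-delta
  conditions coincide.\<close>

lemma tendsto_plane_of_iff:
  fixes \<Psi> :: "bih \<Rightarrow> 'a::metric_space"
  shows "(\<Psi> \<longlongrightarrow> L) (at (plane_of a) within plane_of ` S) \<longleftrightarrow> ((\<lambda>z. \<Psi> (plane_of z)) \<longlongrightarrow> L) (at a within S)"
  unfolding Lim_within by (simp add: inj_eq[OF inj_plane_of])

lemma boundary_limits_iff:
  "boundary_limits \<Phi> \<longleftrightarrow> (\<forall>z. norm z = 1 \<longrightarrow> ((\<lambda>w. \<Phi> (plane_of w)) \<longlongrightarrow> \<Phi> (plane_of z)) (at z within ball 0 1))"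
  by (auto simp: boundary_limits_def bdisk_eq disk_eq tendsto_plane_of_iff)

lemma closure_disk: "closure disk = cdisk"
  using closure_injective_linear_image[OF linear_plane_of inj_plane_of, of "ball 0 1"]
  by (simp add: disk_eq cdisk_eq)

lemma continuous_on_cdiskI:
  assumes "boundary_limits \<Phi>" "continuous_on (ball 0 1) (\<lambda>z. \<Phi> (plane_of z))"
  shows "continuous_on cdisk \<Phi>"
  unfolding closure_disk[symmetric]
proof (rule continuous_on_closureI, unfold closure_disk)
  fix x assume "x \<in> cdisk"
  then obtain z where z: "x = plane_of z" "norm z \<le> 1" by (auto simp: cdisk_eq)
  show "(\<Phi> \<longlongrightarrow> \<Phi> x) (at x within disk)"
  proof (cases "norm z = 1")
    case True then show ?thesis using assms(1) z(1)
      by (auto simp: boundary_limits_iff disk_eq tendsto_plane_of_iff)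
  next
    case False then show ?thesis using assms(2) z
      by (auto simp: disk_eq tendsto_plane_of_iff continuous_on)
  qed
qed

text \<open>Writing \<open>h = k + Im k \<nu>\<close>, the difference quotient has second part
  \<open>\<Delta>n / k - (\<Delta>F / k) (Im k / k)\<close>, in which the two terms containing \<open>Im k / k\<close> cancel in the limit.\<close>

lemma monogenic_onI:
  assumes F: "F holomorphic_on ball 0 1" and F': "\<And>z. norm z < 1 \<Longrightarrow> (F has_field_derivative F' z) (at z)"
    and F0: "F0 holomorphic_on ball 0 1"
    and hom: "\<And>z. norm z < 1 \<Longrightarrow> bih_hom (\<Phi> (plane_of z)) = F z"
    and co: "\<And>z. norm z < 1 \<Longrightarrow> coeff2 (\<Phi> (plane_of z)) = of_real (Im z) * F' z + F0 z"
  shows "monogenic_on disk \<Phi>"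
  unfolding monogenic_on_def
proof
  fix \<zeta> assume "\<zeta> \<in> disk"
  then obtain z where \<zeta>: "\<zeta> = plane_of z" and z: "norm z < 1" by (auto simp: disk_eq)
  define y where "y = complex_of_real (Im z)"
  define k where "k = (\<lambda>h. complex_of_real (Im h) / h)"
  have "F' holomorphic_on ball 0 1"
    using F' by (intro derivative_is_holomorphic[of "ball 0 1" F]) auto
  then obtain d1 where d1: "(F' has_field_derivative d1) (at z)"
    using z holomorphic_on_imp_differentiable_at[of F' "ball 0 1" z] by (auto simp: field_differentiable_def)
  obtain d0 where d0: "(F0 has_field_derivative d0) (at z)"
    using z holomorphic_on_imp_differentiable_at[OF F0, of z] by (auto simp: field_differentiable_def)
  have lF: "(\<lambda>h. (F (z + h) - F z) / h) \<midarrow>0\<rightarrow> F' z" using F'[OF z] by (simp add: DERIV_def)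
  have l1: "(\<lambda>h. (F' (z + h) - F' z) / h) \<midarrow>0\<rightarrow> d1" using d1 by (simp add: DERIV_def)
  have l0: "(\<lambda>h. (F0 (z + h) - F0 z) / h) \<midarrow>0\<rightarrow> d0" using d0 by (simp add: DERIV_def)
  have "isCont F' z" using d1 DERIV_isCont by blast
  then have "(\<lambda>h. F' (z + h)) \<midarrow>0\<rightarrow> F' z" by (simp add: isCont_iff)
  then have "(\<lambda>h. F' (z + h) - (F (z + h) - F z) / h) \<midarrow>0\<rightarrow> F' z - F' z"
    using lF by (intro tendsto_intros)
  then have l: "(\<lambda>h. F' (z + h) - (F (z + h) - F z) / h) \<midarrow>0\<rightarrow> 0" by simp
  \<comment> \<open>The ratio \<open>k h\<close> has no limit at 0, but its norm is at most 1 and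
    the other factor tends to 0.\<close>
  have lk: "(\<lambda>h. k h * (F' (z + h) - (F (z + h) - F z) / h)) \<midarrow>0\<rightarrow> 0"
  proof (rule Lim_null_comparison[OF always_eventually tendsto_norm_zero[OF l]], intro allI)
    fix h
    have "norm (k h) \<le> 1"
      by (simp add: k_def norm_divide divide_le_eq abs_Im_le_cmod)
    then show "norm (k h * (F' (z + h) - (F (z + h) - F z) / h)) \<le> norm (F' (z + h) - (F (z + h) - F z) / h)"
      by (simp add: norm_mult mult_left_le_one_le)
  qed
  have ev: "\<forall>\<^sub>F h in at 0. norm (z + h) < 1 \<and> h \<noteq> 0"
  proof -
    have "\<forall>\<^sub>F h in at 0. h \<in> ball 0 (1 - norm z)" using z by (intro eventually_at_in_open') auto
    moreover have "\<forall>\<^sub>F h in at (0::complex). h \<noteq> 0" by (simp add: eventually_neq_at_within)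
    ultimately show ?thesis
    proof eventually_elim
      case (elim h)
      then show ?case using norm_triangle_ineq[of z h] by simp
    qed
  qed
  \<comment> \<open>The plane is written as an image so that \<open>tendsto_plane_of_iff\<close>
    applies; the final 0 in the limit is the contribution of \<open>lk\<close>.\<close>
  have "((\<lambda>h. (\<Phi> (\<zeta> + h) - \<Phi> \<zeta>) * bih_inverse h) \<longlongrightarrow> of_parts (F' z) (y * d1 + d0 + 0)) (at (plane_of 0) within plane_of ` UNIV)"
    unfolding tendsto_plane_of_iff tendsto_bih_iff
  proof (intro conjI)
    have \<zeta>h: "plane_of z + plane_of h = plane_of (z + h)" for h using linear_add[OF linear_plane_of] by simp
    show "(\<lambda>h. bih_hom ((\<Phi> (\<zeta> + plane_of h) - \<Phi> \<zeta>) * bih_inverse (plane_of h))) \<midarrow>0\<rightarrow> bih_hom (of_parts (F' z) (y * d1 + d0 + 0))"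
      unfolding of_parts_simps
      by (rule Lim_transform_eventually[OF lF], rule eventually_mono[OF ev])
        (use z in \<open>simp add: \<zeta>h \<zeta> hom bih_inverse_simps\<close>)
    have "(\<lambda>h. y * ((F' (z + h) - F' z) / h) + (F0 (z + h) - F0 z) / h + k h * (F' (z + h) - (F (z + h) - F z) / h))
        \<midarrow>0\<rightarrow> y * d1 + d0 + 0"
      by (intro tendsto_intros l1 l0 lk)
    then show "(\<lambda>h. coeff2 ((\<Phi> (\<zeta> + plane_of h) - \<Phi> \<zeta>) * bih_inverse (plane_of h))) \<midarrow>0\<rightarrow> coeff2 (of_parts (F' z) (y * d1 + d0 + 0))"
      unfolding of_parts_simps
    proof (rule Lim_transform_eventually, intro eventually_mono[OF ev])
      fix h assume h: "norm (z + h) < 1 \<and> h \<noteq> 0"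
      show "y * ((F' (z + h) - F' z) / h) + (F0 (z + h) - F0 z) / h + k h * (F' (z + h) - (F (z + h) - F z) / h)
        = coeff2 ((\<Phi> (\<zeta> + plane_of h) - \<Phi> \<zeta>) * bih_inverse (plane_of h))"
        using h z by (simp add: \<zeta>h \<zeta> hom co bih_inverse_simps y_def k_def)
          (simp add: field_simps power2_eq_square)
    qed
  qed
  moreover have "plane_of 0 = 0" using linear_0[OF linear_plane_of] .
  ultimately show "\<exists>L. ((\<lambda>h. (\<Phi> (\<zeta> + h) - \<Phi> \<zeta>) * bih_inverse h) \<longlongrightarrow> L) (at 0 within bih_plane)"
    unfolding bih_plane_eq by auto
qed

text \<open>The left side is the Leibniz expansion of the second part of the integrand, the right
  side the kernels of \<open>cauchy_G\<close> and \<open>cauchy_S\<close> times i t. On the circle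
  t2 = Im t and d = Re t are rational in t, and w stands for cnj z, so only rational functions
  occur.\<close>

lemma schwarz_kernel_identity:
  fixes t z w f g :: complex
  assumes "t \<noteq> 0" "t - z \<noteq> 0" "t2 = (t - 1 / t) / (2 * \<i>)" "y = (z - w) / (2 * \<i>)" "d = (t + 1 / t) / 2"
  shows "f * (t + z) * (1 / (t - z)) * (1 / t) * d
    + (f * (t + z) * (1 / (t - z)) * (- t2 / t\<^sup>2)
      + (f * (t + z) * (- (t2 - y) / (t - z)\<^sup>2) + (f * (t2 + y) + g * (t + z)) * (1 / (t - z))) * (1 / t)) * (\<i> * t)
    = (\<i> * (w * (f / (t - 0) ^ 2) + f / (t - 0) ^ 3) - \<i> * (1 - z * w) * (f * (2 * t - z) / (t\<^sup>2 * (t - z)\<^sup>2))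
        + (2 * (g / (t - z) ^ 1) - g / (t - 0) ^ 1)) * (\<i> * t)"
proof -
  \<comment> \<open>In terms of t and q the denominators are monomials, and clearing them leaves a
    polynomial identity.\<close>
  define q where "q = t - z"
  have q: "q \<noteq> 0" "z = t - q" using assms(2) by (auto simp: q_def)
  show ?thesis
    unfolding assms(3-5) q_def[symmetric] unfolding q(2) using q(1) assms(1)
    by (simp add: field_simps power2_eq_square power3_eq_cube)
qed

lemma has_integral_of_contour:
  assumes "(F has_contour_integral I) (circlepath 0 1)"
  shows "((\<lambda>\<theta>. F (cis \<theta>) * (\<i> * cis \<theta>)) has_integral I) {0..2*pi}"
  using assms has_contour_integral_part_circlepath_iff[of 0 "2*pi" F I 0 1]
  by (simp add: circlepath_def mult_ac)

lemma circ_eq: "circ \<theta> = plane_of (cis \<theta>)" and circ_deriv_eq: "circ_deriv \<theta> = plane_of (\<i> * cis \<theta>)"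
  by (simp_all add: circ_def circ_deriv_def plane_of_def)

text \<open>\<open>bih_hom\<close> turns the integrand into the classical Schwarz kernel times the
  first part of the density; the second part is matched with \<open>cauchy_G\<close> and
  \<open>cauchy_S\<close> by \<open>schwarz_kernel_identity\<close>.\<close>

lemma schwarz_integral_parts:
  assumes f: "continuous_on (sphere 0 1) (\<lambda>z. bih_hom (\<phi> (plane_of z)))"
    and g: "continuous_on (sphere 0 1) (\<lambda>z. coeff2 (\<phi> (plane_of z)))" and z: "norm z < 1"
  shows "bih_hom (schwarz_integral \<phi> (plane_of z)) = cauchy_S (\<lambda>z. bih_hom (\<phi> (plane_of z))) z"
    and "coeff2 (schwarz_integral \<phi> (plane_of z)) = cauchy_G (\<lambda>z. bih_hom (\<phi> (plane_of z))) z + cauchy_S (\<lambda>z. coeff2 (\<phi> (plane_of z))) z"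
proof -
  define F where "F = (\<lambda>z. bih_hom (\<phi> (plane_of z)))"
  define G where "G = (\<lambda>z. coeff2 (\<phi> (plane_of z)))"
  note f = f[folded F_def] note g = g[folded G_def]
  define v where "v = (\<lambda>\<theta>. \<phi> (circ \<theta>) * (circ \<theta> + plane_of z) * bih_inverse (circ \<theta> - plane_of z) * bih_inverse (circ \<theta>) * circ_deriv \<theta>)"
  have nz: "cis \<theta> - z \<noteq> 0" for \<theta> using z norm_cis[of \<theta>] by (metis eq_iff_diff_eq_0 less_irrefl)
  have S: "((\<lambda>t. 2 * (h t / (t - z) ^ 1) - h t / (t - 0) ^ 1) has_contour_integral
      2 * of_real pi * \<i> * cauchy_S h z) (circlepath 0 1)" if "continuous_on (sphere 0 1) h" for h
  proof -
    have "((\<lambda>t. 2 * (h t / (t - z) ^ 1) - h t / (t - 0) ^ 1) has_contour_integral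
      2 * (2 * of_real pi * \<i> * cauchy 1 h z) - 2 * of_real pi * \<i> * cauchy 1 h 0) (circlepath 0 1)"
      by (intro has_contour_integral_diff has_contour_integral_lmul has_contour_integral_cauchy that z) simp
    then show ?thesis by (simp add: cauchy_S_def algebra_simps)
  qed
  have "((\<lambda>\<theta>. bih_hom (v \<theta>)) has_integral 2 * of_real pi * \<i> * cauchy_S F z) {0..2*pi}"
  proof (rule has_integral_eq[OF _ has_integral_of_contour[OF S[OF f]]])
    fix \<theta>
    show "(2 * (F (cis \<theta>) / (cis \<theta> - z) ^ 1) - F (cis \<theta>) / (cis \<theta> - 0) ^ 1) * (\<i> * cis \<theta>) = bih_hom (v \<theta>)"
      using nz[of \<theta>] by (simp add: v_def circ_eq circ_deriv_eq bih_inverse_simps flip: F_def)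
        (simp add: F_def field_simps)
  qed
  moreover
  have "((\<lambda>t. \<i> * (cnj z * (F t / (t - 0) ^ 2) + F t / (t - 0) ^ 3)
      - \<i> * (1 - z * cnj z) * (F t * (2 * t - z) / (t\<^sup>2 * (t - z)\<^sup>2))
      + (2 * (G t / (t - z) ^ 1) - G t / (t - 0) ^ 1)) has_contour_integral
      (\<i> * (cnj z * (2 * of_real pi * \<i> * cauchy 2 F 0) + 2 * of_real pi * \<i> * cauchy 3 F 0)
      - \<i> * (1 - z * cnj z) * (2 * of_real pi * \<i> * cauchy_E F z)
      + 2 * of_real pi * \<i> * cauchy_S G z)) (circlepath 0 1)"
    by (intro has_contour_integral_add has_contour_integral_diff has_contour_integral_lmul
        has_contour_integral_cauchy has_contour_integral_cauchy_E S f g z) simp_all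
  then have "((\<lambda>t. \<i> * (cnj z * (F t / (t - 0) ^ 2) + F t / (t - 0) ^ 3)
      - \<i> * (1 - z * cnj z) * (F t * (2 * t - z) / (t\<^sup>2 * (t - z)\<^sup>2))
      + (2 * (G t / (t - z) ^ 1) - G t / (t - 0) ^ 1)) has_contour_integral
      2 * of_real pi * \<i> * (cauchy_G F z + cauchy_S G z)) (circlepath 0 1)"
    by (simp add: cauchy_G_def complex_norm_square[symmetric] algebra_simps del: of_real_power)
  from has_integral_of_contour[OF this]
  have "((\<lambda>\<theta>. coeff2 (v \<theta>)) has_integral 2 * of_real pi * \<i> * (cauchy_G F z + cauchy_S G z)) {0..2*pi}"
  proof (rule has_integral_eq[rotated])
    fix \<theta>
    \<comment> \<open>On the unit circle inversion is conjugation, which makes sine and cosine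
      rational in \<open>cis \<theta>\<close>.\<close>
    have c: "1 / cis \<theta> = cnj (cis \<theta>)"
      by (simp add: cis_cnj divide_inverse)
    have t2: "complex_of_real (sin \<theta>) = (cis \<theta> - 1 / cis \<theta>) / (2 * \<i>)"
      and d: "complex_of_real (cos \<theta>) = (cis \<theta> + 1 / cis \<theta>) / 2"
      and y: "complex_of_real (Im z) = (z - cnj z) / (2 * \<i>)"
      unfolding c by (simp_all add: complex_eq_iff)
    show "(\<i> * (cnj z * (F (cis \<theta>) / (cis \<theta> - 0) ^ 2) + F (cis \<theta>) / (cis \<theta> - 0) ^ 3)
      - \<i> * (1 - z * cnj z) * (F (cis \<theta>) * (2 * cis \<theta> - z) / ((cis \<theta>)\<^sup>2 * (cis \<theta> - z)\<^sup>2))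
      + (2 * (G (cis \<theta>) / (cis \<theta> - z) ^ 1) - G (cis \<theta>) / (cis \<theta> - 0) ^ 1)) * (\<i> * cis \<theta>) = coeff2 (v \<theta>)"
      using schwarz_kernel_identity[OF cis_neq_zero nz[of \<theta>] t2 y d, of "F (cis \<theta>)" "G (cis \<theta>)"] nz[of \<theta>]
      by (simp only: v_def circ_eq circ_deriv_eq coeff2_mult bih_hom_mult bih_inverse_simps bih_hom_plane_of
          bih_hom_simps coeff2_simps coeff2_plane_of F_def G_def cis_neq_zero not_False_eq_True
          Im_i_times cis.sel)
  qed
  ultimately have "(v has_integral of_parts (2 * of_real pi * \<i> * cauchy_S F z)
      (2 * of_real pi * \<i> * (cauchy_G F z + cauchy_S G z))) {0..2*pi}"
    by (rule has_integral_bih)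
  then have "schwarz_integral \<phi> (plane_of z) = bih_of_complex (1 / (2 * of_real pi * \<i>)) *
     of_parts (2 * of_real pi * \<i> * cauchy_S F z) (2 * of_real pi * \<i> * (cauchy_G F z + cauchy_S G z))"
    unfolding schwarz_integral_def circ_integral_def v_def by (simp add: integral_unique)
  then show "bih_hom (schwarz_integral \<phi> (plane_of z)) = cauchy_S F z"
    and "coeff2 (schwarz_integral \<phi> (plane_of z)) = cauchy_G F z + cauchy_S G z"
    by simp_all
qed

section \<open>The Dini condition\<close>

lemma mod_cont_mono: "\<epsilon> \<le> \<epsilon>' \<Longrightarrow> mod_cont u \<epsilon> \<le> mod_cont u \<epsilon>'"
  unfolding mod_cont_def by (rule SUP_subset_mono) auto

lemma mod_cont_upper:
  assumes "\<tau>\<^sub>1 \<in> bdisk" "\<tau>\<^sub>2 \<in> bdisk" "norm (\<tau>\<^sub>1 - \<tau>\<^sub>2) \<le> \<epsilon>"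
  shows "ennreal (norm (u \<tau>\<^sub>1 - u \<tau>\<^sub>2)) \<le> mod_cont u \<epsilon>"
  unfolding mod_cont_def by (rule SUP_upper2[of "(\<tau>\<^sub>1, \<tau>\<^sub>2)"]) (use assms in auto)

text \<open>This divergence prevents a Dini modulus from staying above \<epsilon> near 0.\<close>

lemma nn_integral_inverse_at_0:
  assumes "0 < \<epsilon>"
  shows "(\<integral>\<^sup>+ \<eta>\<in>{0<..1}. ennreal (\<epsilon> / \<eta>) \<partial>lborel) = \<infinity>"
proof -
  have *: "of_nat n \<le> (\<integral>\<^sup>+ \<eta>\<in>{0<..1}. ennreal (\<epsilon> / \<eta>) \<partial>lborel)" for n
  proof -
    \<comment> \<open>Chosen so that the integral over [\<delta>, 1], which is -\<epsilon> ln
      \<delta>, equals n.\<close>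
    define \<delta> where "\<delta> = exp (- (real n / \<epsilon>))"
    have \<delta>: "0 < \<delta>" "\<delta> \<le> 1" using assms by (auto simp: \<delta>_def)
    have "(\<integral>\<^sup>+ \<eta>. ennreal (\<epsilon> / \<eta>) * indicator {\<delta>..1} \<eta> \<partial>lborel) = \<epsilon> * ln 1 - \<epsilon> * ln \<delta>"
      by (rule nn_integral_FTC_Icc) (use \<delta> assms in \<open>auto intro!: derivative_eq_intros\<close>)
    also have "\<epsilon> * ln 1 - \<epsilon> * ln \<delta> = real n" using assms by (simp add: \<delta>_def)
    finally have "of_nat n = (\<integral>\<^sup>+ \<eta>. ennreal (\<epsilon> / \<eta>) * indicator {\<delta>..1} \<eta> \<partial>lborel)"
      by (simp add: ennreal_of_nat_eq_real_of_nat)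
    also have "\<dots> \<le> (\<integral>\<^sup>+ \<eta>\<in>{0<..1}. ennreal (\<epsilon> / \<eta>) \<partial>lborel)"
      by (rule nn_integral_mono) (use \<delta> in \<open>auto split: split_indicator\<close>)
    finally show ?thesis .
  qed
  show ?thesis
  proof (rule ccontr)
    assume "(\<integral>\<^sup>+ \<eta>\<in>{0<..1}. ennreal (\<epsilon> / \<eta>) \<partial>lborel) \<noteq> \<infinity>"
    then obtain n where "(\<integral>\<^sup>+ \<eta>\<in>{0<..1}. ennreal (\<epsilon> / \<eta>) \<partial>lborel) < of_nat n"
      using ennreal_Ex_less_of_nat by (auto simp: less_top)
    then show False using *[of n] by simp
  qed
qed

text \<open>Otherwise the Dini integrand would dominate \<epsilon>/\<eta>, whose integral over (0,
  1] diverges.\<close>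

lemma Dini_mod_cont_small:
  assumes "Dini u" "0 < \<epsilon>"
  obtains \<eta> where "0 < \<eta>" "mod_cont u \<eta> < ennreal \<epsilon>"
proof -
  have "\<exists>\<eta>>0. mod_cont u \<eta> < ennreal \<epsilon>"
  proof (rule ccontr)
    assume "\<not> ?thesis"
    then have ge: "ennreal \<epsilon> \<le> mod_cont u \<eta>" if "0 < \<eta>" for \<eta>
      using that by (meson not_less)
    have "(\<integral>\<^sup>+ \<eta>\<in>{0<..1}. ennreal (\<epsilon> / \<eta>) \<partial>lborel) \<le> (\<integral>\<^sup>+ \<eta>\<in>{0<..1}. (mod_cont u \<eta> / ennreal \<eta>) \<partial>lborel)"
      by (rule nn_integral_mono)
        (use assms(2) in \<open>auto split: split_indicator intro!: divide_right_mono_ennreal ge simp flip: divide_ennreal\<close>)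
    then show False
      using assms nn_integral_inverse_at_0[OF assms(2)] by (simp add: Dini_def)
  qed
  with that show ?thesis by blast
qed

lemma Dini_continuous:
  assumes "Dini u"
  shows "continuous_on bdisk u"
  unfolding continuous_on_iff
proof (intro ballI allI impI)
  fix \<tau> and e :: real assume "\<tau> \<in> bdisk" "0 < e"
  obtain \<eta> where \<eta>: "0 < \<eta>" "mod_cont u \<eta> < ennreal e" using Dini_mod_cont_small[OF assms \<open>0 < e\<close>] .
  have "dist (u \<tau>') (u \<tau>) < e" if "\<tau>' \<in> bdisk" "dist \<tau>' \<tau> < \<eta>" for \<tau>'
  proof -
    have "ennreal (norm (u \<tau>' - u \<tau>)) < ennreal e"
      using mod_cont_upper[of \<tau>' \<tau> \<eta> u] that \<open>\<tau> \<in> bdisk\<close> \<eta>(2) by (simp add: dist_norm order_le_less_trans)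
    then show ?thesis by (simp add: dist_norm ennreal_less_iff)
  qed
  then show "\<exists>d>0. \<forall>x'\<in>bdisk. dist x' \<tau> < d \<longrightarrow> dist (u x') (u \<tau>) < e" using \<eta>(1) by blast
qed

lemma compact_bdisk: "compact bdisk"
  unfolding bdisk_eq
  by (intro compact_continuous_image linear_continuous_on linear_plane_of compact_sphere
      linear_conv_bounded_linear[THEN iffD1])

text \<open>A Dini function is continuous, hence bounded on the compact circle, so its modulus is
  finite; being monotone, the modulus is measurable. This trades the extended integral for an
  integrable real function.\<close>

lemma Dini_real_modulus:
  fixes u :: "bih \<Rightarrow> 'a :: real_normed_vector"
  assumes "Dini u"
  shows "\<exists>M B. mono M \<and> (\<forall>\<eta>. 0 \<le> M \<eta> \<and> M \<eta> \<le> B \<and> mod_cont u \<eta> = ennreal (M \<eta>)) \<and>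
    (\<lambda>\<eta>. if 0 < \<eta> \<and> \<eta> \<le> 1 then M \<eta> / \<eta> else 0) integrable_on UNIV \<and>
    (\<forall>\<tau>\<^sub>1 \<in> bdisk. \<forall>\<tau>\<^sub>2 \<in> bdisk. \<forall>\<epsilon>. norm (\<tau>\<^sub>1 - \<tau>\<^sub>2) \<le> \<epsilon> \<longrightarrow> norm (u \<tau>\<^sub>1 - u \<tau>\<^sub>2) \<le> M \<epsilon>)"
proof -
  define M where "M = (\<lambda>\<eta>. enn2real (mod_cont u \<eta>))"
  have "bounded (u ` bdisk)"
    by (intro compact_imp_bounded compact_continuous_image Dini_continuous assms compact_bdisk)
  then obtain B where B: "\<And>\<tau>. \<tau> \<in> bdisk \<Longrightarrow> norm (u \<tau>) \<le> B" by (auto simp: bounded_iff)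
  have le: "mod_cont u \<eta> \<le> ennreal (2 * B)" for \<eta>
  proof -
    have "norm (u \<tau>\<^sub>1 - u \<tau>\<^sub>2) \<le> 2 * B" if "\<tau>\<^sub>1 \<in> bdisk" "\<tau>\<^sub>2 \<in> bdisk" for \<tau>\<^sub>1 \<tau>\<^sub>2
      using norm_triangle_ineq4[of "u \<tau>\<^sub>1" "u \<tau>\<^sub>2"] B[OF that(1)] B[OF that(2)] by simp
    then show ?thesis unfolding mod_cont_def by (auto intro!: SUP_least ennreal_leI)
  qed
  have fin: "mod_cont u \<eta> < top" for \<eta>
    using le[of \<eta>] by (rule order_le_less_trans) simp
  have M: "mod_cont u \<eta> = ennreal (M \<eta>)" for \<eta>
    using fin by (simp add: M_def)
  have M0: "0 \<le> M \<eta>" for \<eta> by (simp add: M_def)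
  have mono: "mono M"
    unfolding M_def by (intro monoI enn2real_mono mod_cont_mono fin)
  \<comment> \<open>A point of the circle is exhibited to obtain \<open>0 \<le> B\<close>.\<close>
  have "plane_of 1 \<in> bdisk" by (simp add: bdisk_eq)
  from B[OF this] have B0: "0 \<le> B" using norm_ge_zero order_trans by blast
  have MB: "M \<eta> \<le> 2 * B" for \<eta>
    using le[of \<eta>] B0 by (simp add: M)
  define k where "k = (\<lambda>\<eta>::real. if 0 < \<eta> \<and> \<eta> \<le> 1 then M \<eta> / \<eta> else 0)"
  have [measurable]: "M \<in> borel_measurable borel" using mono by (rule borel_measurable_mono)
  have kk: "ennreal (k \<eta>) = mod_cont u \<eta> / ennreal \<eta> * indicator {0<..1} \<eta>" for \<eta>
    by (auto simp: k_def M divide_ennreal M0 split: split_indicator)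
  have "k integrable_on UNIV"
  proof (rule nn_integral_integrable_on)
    show "k \<in> borel_measurable borel" unfolding k_def by measurable
    show "0 \<le> k x" for x by (simp add: k_def M0)
    show "(\<integral>\<^sup>+ x. ennreal (k x) \<partial>lborel) < \<infinity>" using assms unfolding kk Dini_def .
  qed
  moreover have "norm (u \<tau>\<^sub>1 - u \<tau>\<^sub>2) \<le> M \<epsilon>" if "\<tau>\<^sub>1 \<in> bdisk" "\<tau>\<^sub>2 \<in> bdisk" "norm (\<tau>\<^sub>1 - \<tau>\<^sub>2) \<le> \<epsilon>" for \<tau>\<^sub>1 \<tau>\<^sub>2 \<epsilon>
    using mod_cont_upper[OF that, of u] by (simp add: M M0)
  ultimately show ?thesis
    using mono M0 MB M unfolding k_def by (intro exI[of _ M] exI[of _ "2 * B"]) blast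
qed

text \<open>After division by \<eta> the Lipschitz term contributes only the constant C, integrable
  on (0, 1]. This admits densities that differ from the data by affine terms.\<close>

lemma Dini_combine:
  fixes \<phi> :: "bih \<Rightarrow> 'a :: real_normed_vector"
  assumes u: "Dini u" and v: "Dini v" and C: "0 \<le> C"
    and le: "\<And>\<tau>\<^sub>1 \<tau>\<^sub>2. \<tau>\<^sub>1 \<in> bdisk \<Longrightarrow> \<tau>\<^sub>2 \<in> bdisk \<Longrightarrow>
      norm (\<phi> \<tau>\<^sub>1 - \<phi> \<tau>\<^sub>2) \<le> norm (u \<tau>\<^sub>1 - u \<tau>\<^sub>2) + norm (v \<tau>\<^sub>1 - v \<tau>\<^sub>2) + C * norm (\<tau>\<^sub>1 - \<tau>\<^sub>2)"
  shows "Dini \<phi>"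
proof -
  obtain M B where M: "mono M" "\<And>\<eta>. 0 \<le> M \<eta>" "\<And>\<eta>. M \<eta> \<le> B" "\<And>\<eta>. mod_cont u \<eta> = ennreal (M \<eta>)"
    "(\<lambda>\<eta>. if 0 < \<eta> \<and> \<eta> \<le> 1 then M \<eta> / \<eta> else 0) integrable_on UNIV"
    "\<And>\<tau>\<^sub>1 \<tau>\<^sub>2 \<epsilon>. \<tau>\<^sub>1 \<in> bdisk \<Longrightarrow> \<tau>\<^sub>2 \<in> bdisk \<Longrightarrow> norm (\<tau>\<^sub>1 - \<tau>\<^sub>2) \<le> \<epsilon> \<Longrightarrow> norm (u \<tau>\<^sub>1 - u \<tau>\<^sub>2) \<le> M \<epsilon>"
    using Dini_real_modulus[OF u] by blast
  obtain N B' where N: "mono N" "\<And>\<eta>. 0 \<le> N \<eta>" "\<And>\<eta>. N \<eta> \<le> B'" "\<And>\<eta>. mod_cont v \<eta> = ennreal (N \<eta>)"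
    "(\<lambda>\<eta>. if 0 < \<eta> \<and> \<eta> \<le> 1 then N \<eta> / \<eta> else 0) integrable_on UNIV"
    "\<And>\<tau>\<^sub>1 \<tau>\<^sub>2 \<epsilon>. \<tau>\<^sub>1 \<in> bdisk \<Longrightarrow> \<tau>\<^sub>2 \<in> bdisk \<Longrightarrow> norm (\<tau>\<^sub>1 - \<tau>\<^sub>2) \<le> \<epsilon> \<Longrightarrow> norm (v \<tau>\<^sub>1 - v \<tau>\<^sub>2) \<le> N \<epsilon>"
    using Dini_real_modulus[OF v] by blast
  have [measurable]: "M \<in> borel_measurable borel" "N \<in> borel_measurable borel"
    using M(1) N(1) by (auto intro: borel_measurable_mono)
  have mc: "mod_cont \<phi> \<eta> / ennreal \<eta> \<le> ennreal (M \<eta>) / ennreal \<eta> + ennreal (N \<eta>) / ennreal \<eta> + ennreal C" if "0 < \<eta>" for \<eta>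
  proof -
    have "mod_cont \<phi> \<eta> \<le> ennreal (M \<eta> + N \<eta> + C * \<eta>)"
      unfolding mod_cont_def
    proof (rule SUP_least, clarify)
      fix \<tau>\<^sub>1 \<tau>\<^sub>2 assume \<tau>: "\<tau>\<^sub>1 \<in> bdisk" "\<tau>\<^sub>2 \<in> bdisk" "norm (\<tau>\<^sub>1 - \<tau>\<^sub>2) \<le> \<eta>"
      show "ennreal (norm (\<phi> \<tau>\<^sub>1 - \<phi> \<tau>\<^sub>2)) \<le> ennreal (M \<eta> + N \<eta> + C * \<eta>)"
        using le[OF \<tau>(1,2)] M(6)[OF \<tau>] N(6)[OF \<tau>] mult_left_mono[OF \<tau>(3) C]
        by (intro ennreal_leI) linarith
    qed
    then have "mod_cont \<phi> \<eta> / ennreal \<eta> \<le> ennreal (M \<eta> + N \<eta> + C * \<eta>) / ennreal \<eta>"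
      by (rule divide_right_mono_ennreal)
    also have "\<dots> = ennreal (M \<eta> / \<eta> + N \<eta> / \<eta> + C)"
    proof -
      have "(M \<eta> + N \<eta> + C * \<eta>) / \<eta> = M \<eta> / \<eta> + N \<eta> / \<eta> + C"
        using that by (simp add: field_simps)
      moreover have "0 \<le> M \<eta> + N \<eta> + C * \<eta>" using that M(2)[of \<eta>] N(2)[of \<eta>] C by simp
      ultimately show ?thesis using divide_ennreal that by metis
    qed
    also have "\<dots> = ennreal (M \<eta>) / ennreal \<eta> + ennreal (N \<eta>) / ennreal \<eta> + ennreal C"
      using that M(2)[of \<eta>] N(2)[of \<eta>] C by (simp add: divide_ennreal)
    finally show ?thesis .
  qed
  have "(\<integral>\<^sup>+ \<eta>\<in>{0<..1}. (mod_cont \<phi> \<eta> / ennreal \<eta>) \<partial>lborel) \<le>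
    (\<integral>\<^sup>+ \<eta>. (ennreal (M \<eta>) / ennreal \<eta> * indicator {0<..1} \<eta> + ennreal (N \<eta>) / ennreal \<eta> * indicator {0<..1} \<eta>)
       + ennreal C * indicator {0<..1} \<eta> \<partial>lborel)"
    by (rule nn_integral_mono) (use mc in \<open>auto split: split_indicator\<close>)
  also have "\<dots> = (\<integral>\<^sup>+ \<eta>\<in>{0<..1}. (mod_cont u \<eta> / ennreal \<eta>) \<partial>lborel) + (\<integral>\<^sup>+ \<eta>\<in>{0<..1}. (mod_cont v \<eta> / ennreal \<eta>) \<partial>lborel)
      + (\<integral>\<^sup>+ \<eta>\<in>{0<..1::real}. ennreal C \<partial>lborel)"
    unfolding M(4) N(4) by (simp add: nn_integral_add)
  also have "\<dots> < \<infinity>"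
    using u v by (simp add: Dini_def nn_integral_cmult_indicator ennreal_mult_less_top)
  finally show ?thesis by (simp add: Dini_def)
qed

section \<open>From moduli in the chord length to dominating functions of the angle\<close>

lemma abs_le_norm_cis:
  assumes "\<bar>\<theta>\<bar> \<le> 1"
  shows "\<bar>\<theta>\<bar> \<le> 2 * norm (cis \<theta> - 1)"
proof -
  \<comment> \<open>The quadratic Taylor term of the sine vanishes, so three terms leave a cubic
    remainder; for |\<theta>| \<le> 1 it is at most |\<theta>|/6, ample for the factor 2.\<close>
  have "\<bar>sin \<theta> - \<theta>\<bar> \<le> \<bar>\<theta>\<bar> ^ 3 / 6"
  proof -
    have "(\<Sum>m<3. sin_coeff m * \<theta> ^ m) = \<theta>" by (simp add: eval_nat_numeral sin_coeff_def)
    moreover have "fact 3 = (6::real)" by (simp add: fact_numeral)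
    ultimately show ?thesis
      using Maclaurin_sin_bound[of \<theta> 3] by (simp only: divide_inverse mult.commute)
  qed
  also have "\<dots> \<le> \<bar>\<theta>\<bar> / 6"
  proof -
    have "\<bar>\<theta>\<bar> ^ 3 \<le> \<bar>\<theta>\<bar> ^ 1" by (rule power_decreasing) (use assms in auto)
    then show ?thesis by (simp only: power_one_right divide_right_mono)
  qed
  finally have "\<bar>\<theta>\<bar> \<le> 2 * \<bar>sin \<theta>\<bar>" by linarith
  also have "\<bar>sin \<theta>\<bar> \<le> norm (cis \<theta> - 1)"
    using abs_Im_le_cmod[of "cis \<theta> - 1"] by simp
  finally show ?thesis by simp
qed

lemma norm_cis_le_abs: "norm (cis \<theta> - 1) \<le> \<bar>\<theta>\<bar>"
proof -
  have "norm (cis \<theta> - 1) = 2 * \<bar>sin (\<theta> / 2)\<bar>"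
    using dist_exp_i_1[of \<theta>] by (simp add: cis_conv_exp)
  also have "\<dots> \<le> \<bar>\<theta>\<bar>" using abs_sin_x_le_abs_x[of "\<theta> / 2"] by (simp add: abs_mult)
  finally show ?thesis .
qed

text \<open>Near angle 0 the quotient M(|\<theta>|)/|\<theta>| is integrable by the Dini condition
  and chord and arc are comparable; away from 0 the chord is bounded below and the modulus
  above.\<close>

lemma dini_circle_of_Dini:
  fixes u :: "bih \<Rightarrow> 'a :: real_normed_vector"
  assumes u: "Dini u" and C: "0 \<le> C"
    and le: "\<And>\<tau>\<^sub>1 \<tau>\<^sub>2. norm (f (plane_of \<tau>\<^sub>1) - f (plane_of \<tau>\<^sub>2)) \<le> C * norm (u (plane_of \<tau>\<^sub>1) - u (plane_of \<tau>\<^sub>2))"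
  shows "dini_circle (\<lambda>t. f (plane_of t))"
proof -
  obtain M B where M: "mono M" "\<And>\<eta>. 0 \<le> M \<eta>" "\<And>\<eta>. M \<eta> \<le> B" "\<And>\<eta>. mod_cont u \<eta> = ennreal (M \<eta>)"
    "(\<lambda>\<eta>. if 0 < \<eta> \<and> \<eta> \<le> 1 then M \<eta> / \<eta> else 0) integrable_on UNIV"
    "\<And>\<tau>\<^sub>1 \<tau>\<^sub>2 \<epsilon>. \<tau>\<^sub>1 \<in> bdisk \<Longrightarrow> \<tau>\<^sub>2 \<in> bdisk \<Longrightarrow> norm (\<tau>\<^sub>1 - \<tau>\<^sub>2) \<le> \<epsilon> \<Longrightarrow> norm (u \<tau>\<^sub>1 - u \<tau>\<^sub>2) \<le> M \<epsilon>"
    using Dini_real_modulus[OF u] by blast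
  define k where "k = (\<lambda>\<eta>::real. if 0 < \<eta> \<and> \<eta> \<le> 1 then M \<eta> / \<eta> else 0)"
  \<comment> \<open>The factor 2 comes from \<open>abs_le_norm_cis\<close>, the sum
    \<open>k \<theta> + k (- \<theta>)\<close> covers both signs, and the constant handles
    |\<theta>| > 1, where the chord is at least 1 - cos 1.\<close>
  define h where "h = (\<lambda>\<theta>. 2 * C * (k \<theta> + k (- \<theta>)) + C * B / (1 - cos 1))"
  have B: "0 \<le> B" using M(2,3) order_trans by blast
  have cos1: "cos 1 < (1::real)" using cos_monotone_0_pi[of 0 1] pi_gt3 by simp
  have k0: "0 \<le> k \<eta>" for \<eta> using M(2) by (simp add: k_def)
  have "k integrable_on {-pi..pi}"
    by (rule integrable_on_subinterval[OF M(5)[folded k_def]]) simp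
  moreover from this have "(\<lambda>\<theta>. k (- \<theta>)) integrable_on {-pi..pi}"
    using Henstock_Kurzweil_Integration.integrable_reflect_real[where f = k and a = "- pi" and b = pi] by simp
  ultimately have "h integrable_on {-pi..pi}"
    unfolding h_def by (intro integrable_add integrable_on_mult_right) auto
  moreover have "0 \<le> h \<theta>" for \<theta>
    using k0[of \<theta>] k0[of "-\<theta>"] C B cos1 by (simp add: h_def)
  moreover have "norm (f (plane_of (s * cis \<theta>)) - f (plane_of s)) \<le> norm (cis \<theta> - 1) * h \<theta>"
    if s: "norm s = 1" and \<theta>: "\<theta> \<in> {-pi..pi}" for s \<theta>
  proof -
    have bd: "plane_of (s * cis \<theta>) \<in> bdisk" "plane_of s \<in> bdisk" using s by (auto simp: bdisk_eq norm_mult)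
    have d: "norm (plane_of (s * cis \<theta>) - plane_of s) = norm (cis \<theta> - 1)"
      using dist_plane_of[of "s * cis \<theta>" s] s
      by (metis dist_norm mult.right_neutral norm_mult right_diff_distrib mult_1)
    have f: "norm (f (plane_of (s * cis \<theta>)) - f (plane_of s)) \<le> C * M \<epsilon>" if "norm (cis \<theta> - 1) \<le> \<epsilon>" for \<epsilon>
      using le[of "s * cis \<theta>" s] mult_left_mono[OF M(6)[OF bd] C, of \<epsilon>] that d by simp
    show ?thesis
    proof (cases "\<bar>\<theta>\<bar> \<le> 1")
      case True
      show ?thesis
      proof (cases "\<theta> = 0")
        case False
        have "k \<bar>\<theta>\<bar> \<le> k \<theta> + k (- \<theta>)" using k0[of \<theta>] k0[of "-\<theta>"] by (cases "0 \<le> \<theta>") auto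
        have "norm (f (plane_of (s * cis \<theta>)) - f (plane_of s)) \<le> C * M \<bar>\<theta>\<bar>"
          by (rule f) (rule norm_cis_le_abs)
        also have "\<dots> = C * (\<bar>\<theta>\<bar> * k \<bar>\<theta>\<bar>)" using True False by (simp add: k_def)
        also have "\<dots> \<le> C * ((2 * norm (cis \<theta> - 1)) * (k \<theta> + k (- \<theta>)))"
          by (intro mult_left_mono mult_mono abs_le_norm_cis True C k0) (use \<open>k \<bar>\<theta>\<bar> \<le> _\<close> in auto)
        also have "\<dots> = norm (cis \<theta> - 1) * (2 * C * (k \<theta> + k (- \<theta>)))" by simp
        also have "\<dots> \<le> norm (cis \<theta> - 1) * h \<theta>"
          unfolding h_def using C B cos1 by (intro mult_left_mono) auto
        finally show ?thesis .
      qed simp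
    next
      case False
      have "cos \<theta> \<le> cos 1"
        using cos_monotone_0_pi_le[of 1 "\<bar>\<theta>\<bar>"] False \<theta> by auto
      moreover have "1 - cos \<theta> \<le> norm (cis \<theta> - 1)"
        using abs_Re_le_cmod[of "cis \<theta> - 1"] by simp
      ultimately have c: "1 - cos 1 \<le> norm (cis \<theta> - 1)" by simp
      have "norm (f (plane_of (s * cis \<theta>)) - f (plane_of s)) \<le> C * M (norm (cis \<theta> - 1))"
        by (rule f) simp
      also have "\<dots> \<le> C * B" by (rule mult_left_mono[OF M(3) C])
      also have "\<dots> = (1 - cos 1) * (C * B / (1 - cos 1))" using cos1 by simp
      also have "\<dots> \<le> norm (cis \<theta> - 1) * h \<theta>"
        unfolding h_def using c C B cos1 k0 by (intro mult_mono) auto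
      finally show ?thesis .
    qed
  qed
  moreover have "continuous_on (sphere 0 1) (\<lambda>t. f (plane_of t))"
    unfolding continuous_on_iff
  proof (intro ballI allI impI)
    fix t :: complex and e :: real assume t: "t \<in> sphere 0 1" and e: "0 < e"
    \<comment> \<open>Adding 1 keeps the denominator positive when C = 0.\<close>
    have "0 < e / (C + 1)" using e C by simp
    then obtain d where d: "d > 0" "\<And>\<tau>. \<tau> \<in> bdisk \<Longrightarrow> dist \<tau> (plane_of t) < d \<Longrightarrow> dist (u \<tau>) (u (plane_of t)) < e / (C + 1)"
      using Dini_continuous[OF u] t unfolding continuous_on_iff bdisk_eq by blast
    have "dist (f (plane_of t')) (f (plane_of t)) < e" if "t' \<in> sphere 0 1" "dist t' t < d" for t'
    proof -
      have "dist (u (plane_of t')) (u (plane_of t)) < e / (C + 1)"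
        using d(2)[of "plane_of t'"] that by (auto simp: bdisk_eq)
      then have "(C + 1) * dist (u (plane_of t')) (u (plane_of t)) < e" using C by (simp add: field_simps)
      moreover have "dist (f (plane_of t')) (f (plane_of t)) \<le> C * dist (u (plane_of t')) (u (plane_of t))"
        using le by (simp add: dist_norm)
      moreover have "C * dist (u (plane_of t')) (u (plane_of t)) \<le> (C + 1) * dist (u (plane_of t')) (u (plane_of t))"
        by (simp add: distrib_right)
      ultimately show ?thesis by linarith
    qed
    then show "\<exists>d>0. \<forall>x'\<in>sphere 0 1. dist x' t < d \<longrightarrow> dist (f (plane_of x')) (f (plane_of t)) < e"
      using d(1) by blast
  qed
  ultimately show ?thesis unfolding dini_circle_def by blast
qed

lemma norm_coeff2_le: "norm (coeff2 v) \<le> norm v"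
  and norm_bih_hom_le: "norm (bih_hom v) \<le> 2 * norm v"
proof -
  have c: "norm (coeff2 v) \<le> norm v" "norm (coeff1 v) \<le> norm v"
    by (simp_all add: norm_bih_def real_le_rsqrt)
  then show "norm (coeff2 v) \<le> norm v" by simp
  show "norm (bih_hom v) \<le> 2 * norm v"
    using norm_triangle_ineq[of "coeff1 v" "\<i> * coeff2 v"] c by (simp add: bih_hom_def norm_mult)
qed

lemma dini_circle_parts:
  assumes "Dini \<phi>"
  shows "dini_circle (\<lambda>t. bih_hom (\<phi> (plane_of t)))" "dini_circle (\<lambda>t. coeff2 (\<phi> (plane_of t)))"
proof -
  show "dini_circle (\<lambda>t. bih_hom (\<phi> (plane_of t)))"
    by (rule dini_circle_of_Dini[OF assms, of 2]) (auto simp flip: bih_hom_simps intro: norm_bih_hom_le)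
  show "dini_circle (\<lambda>t. coeff2 (\<phi> (plane_of t)))"
    by (rule dini_circle_of_Dini[OF assms, of 1]) (auto simp flip: coeff2_simps intro: norm_coeff2_le)
qed

lemma dini_circle_of_real:
  assumes "Dini u"
  shows "dini_circle (\<lambda>t. complex_of_real (u (plane_of t)))"
  by (rule dini_circle_of_Dini[OF assms, of 1]) (auto simp flip: of_real_diff)

section \<open>The boundary value problem\<close>

lemma dini_circle_imp_continuous: "dini_circle f \<Longrightarrow> continuous_on (sphere 0 1) f"
  by (simp add: dini_circle_def)

lemma at_within_ball_neq_bot:
  assumes "norm z = 1"
  shows "at z within ball (0::complex) 1 \<noteq> bot"
  using assms by (simp add: at_within_ball_bot_iff)

lemma cauchy_S_const: "norm z < 1 \<Longrightarrow> cauchy_S (\<lambda>t. c) z = c"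
  by (simp add: cauchy_S_def cauchy_const[unfolded One_nat_def])

lemma cauchy_S_ident: "norm z < 1 \<Longrightarrow> cauchy_S (\<lambda>t. t) z = 2 * z"
  by (simp add: cauchy_S_def cauchy_ident[unfolded One_nat_def])

text \<open>By \<open>affine_cauchy_S\<close> both \<open>cauchy_E f\<close> and the constant term
  vanish, and only the antiholomorphic term remains.\<close>

lemma cauchy_G_of_affine:
  assumes "continuous_on (sphere 0 1) f" "\<And>z. norm z < 1 \<Longrightarrow> cauchy_S f z = 2 * c * z + d" "norm z < 1"
  shows "cauchy_G f z = \<i> * c * cnj z"
  using affine_cauchy_S[OF assms(1,2)] assms(3) by (simp add: cauchy_G_def)

lemma cauchy_G_const: "norm z < 1 \<Longrightarrow> cauchy_G (\<lambda>t. c) z = 0"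
  using cauchy_G_of_affine[of "\<lambda>t. c" 0 c z] by (simp add: cauchy_S_const)

lemma cauchy_G_ident: "norm z < 1 \<Longrightarrow> cauchy_G (\<lambda>t. t) z = \<i> * cnj z"
  using cauchy_G_of_affine[of "\<lambda>t. t" 1 0 z] by (simp add: cauchy_S_ident)

text \<open>The first coefficient is \<open>bih_hom w - \<i> * coeff2 w\<close>. Since U3 involves
  the second part alone, its boundary condition is exploited first when a given solution is
  analysed.\<close>

lemma U_bih_hom: "U1 w = Re (bih_hom w) + Im (coeff2 w)" "U3 w = Re (coeff2 w)"
  by (simp_all add: U1_def U3_def bih_hom_def)

lemma S_disk_parts:
  assumes "Dini u" "norm z < 1"
  shows "bih_hom (S_disk u (plane_of z)) = cauchy_S (\<lambda>t. of_real (u (plane_of t))) z"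
    "coeff2 (S_disk u (plane_of z)) = cauchy_G (\<lambda>t. of_real (u (plane_of t))) z"
proof -
  have c: "continuous_on (sphere 0 1) (\<lambda>t. complex_of_real (u (plane_of t)))"
    by (rule dini_circle_imp_continuous[OF dini_circle_of_real[OF assms(1)]])
  show "bih_hom (S_disk u (plane_of z)) = cauchy_S (\<lambda>t. of_real (u (plane_of t))) z"
    "coeff2 (S_disk u (plane_of z)) = cauchy_G (\<lambda>t. of_real (u (plane_of t))) z"
    unfolding S_disk_def using c assms(2)
    by (simp_all add: schwarz_integral_parts cauchy_S_const)
qed

text \<open>The right-hand side of the solution formula, with \<open>\<alpha> = b + i a\<close>, \<open>\<beta>\<^sub>k = b\<^sub>k + i a\<^sub>k\<close>.\<close>

definition solution :: "(bih \<Rightarrow> real) \<Rightarrow> (bih \<Rightarrow> real) \<Rightarrow> complex \<Rightarrow> complex \<Rightarrow> complex \<Rightarrow> bih \<Rightarrow> bih"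
  where "solution u\<^sub>1 u\<^sub>3 \<alpha> \<beta>\<^sub>1 \<beta>\<^sub>2 \<zeta> = S_disk u\<^sub>1 \<zeta> * e1 + S_disk u\<^sub>3 \<zeta> * e2 + bih_of_complex \<alpha> * \<zeta>
    + bih_of_complex \<beta>\<^sub>1 * e1 + bih_of_complex \<beta>\<^sub>2 * e2"

lemma solution_Complex:
  "solution u\<^sub>1 u\<^sub>3 (Complex b a) (Complex b\<^sub>1 a\<^sub>1) (Complex b\<^sub>2 a\<^sub>2) \<zeta> =
    S_disk u\<^sub>1 \<zeta> * e1 + S_disk u\<^sub>3 \<zeta> * e2 + b *\<^sub>R \<zeta> + b\<^sub>1 *\<^sub>R e1 + b\<^sub>2 *\<^sub>R e2
            + bih_of_complex \<i> * (a *\<^sub>R \<zeta> + a\<^sub>1 *\<^sub>R e1 + a\<^sub>2 *\<^sub>R e2)"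
  by (rule bih_eqI) (simp_all add: solution_def Complex_eq algebra_simps)

text \<open>The image under \<open>bih_hom\<close> of the density
  \<open>u\<^sub>1 e1 + u\<^sub>3 e2\<close>, whose second part is \<open>u\<^sub>3\<close>.\<close>

definition bdry_density :: "(bih \<Rightarrow> real) \<Rightarrow> (bih \<Rightarrow> real) \<Rightarrow> complex \<Rightarrow> complex"
  where "bdry_density u\<^sub>1 u\<^sub>3 = (\<lambda>t. of_real (u\<^sub>1 (plane_of t)) + \<i> * of_real (u\<^sub>3 (plane_of t)))"

text \<open>The index is the exponent in the kernel: indices 2 and 3 give
  \<open>\<kappa>\<^sub>1\<close> and \<open>\<kappa>\<^sub>2\<close>.\<close>

definition bdry_coeff :: "(bih \<Rightarrow> real) \<Rightarrow> (bih \<Rightarrow> real) \<Rightarrow> nat \<Rightarrow> complex"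
  where "bdry_coeff u\<^sub>1 u\<^sub>3 n = cauchy n (bdry_density u\<^sub>1 u\<^sub>3) 0"

section \<open>The solution formula: parts, boundary values, membership in the class\<close>

context
  fixes u\<^sub>1 u\<^sub>3 :: "bih \<Rightarrow> real"
  assumes u: "Dini u\<^sub>1" "Dini u\<^sub>3"
begin

abbreviation (input) f\<^sub>1 where "f\<^sub>1 \<equiv> \<lambda>t. complex_of_real (u\<^sub>1 (plane_of t))"
abbreviation (input) f\<^sub>3 where "f\<^sub>3 \<equiv> \<lambda>t. complex_of_real (u\<^sub>3 (plane_of t))"

lemma dini_data: "dini_circle f\<^sub>1" "dini_circle f\<^sub>3" "dini_circle (bdry_density u\<^sub>1 u\<^sub>3)"
proof -
  show "dini_circle f\<^sub>1" "dini_circle f\<^sub>3" using u by (auto intro: dini_circle_of_real)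
  then show "dini_circle (bdry_density u\<^sub>1 u\<^sub>3)"
    unfolding bdry_density_def by (intro dini_circle_add dini_circle_cmult)
qed

lemmas cont_data = dini_data[THEN dini_circle_imp_continuous]

lemma bdry_coeff_eq: "bdry_coeff u\<^sub>1 u\<^sub>3 n = cauchy n f\<^sub>1 0 + \<i> * cauchy n f\<^sub>3 0"
  unfolding bdry_coeff_def bdry_density_def
  by (subst cauchy_add) (use cont_data in \<open>auto simp: cauchy_cmult intro!: continuous_intros\<close>)

lemma S_density:
  assumes "norm z < 1"
  shows "cauchy_S (bdry_density u\<^sub>1 u\<^sub>3) z = cauchy_S f\<^sub>1 z + \<i> * cauchy_S f\<^sub>3 z"
  unfolding bdry_density_def using cont_data assms
  by (subst cauchy_S_add) (auto simp: cauchy_S_cmult intro!: continuous_intros)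

lemma G_density:
  assumes "norm z < 1"
  shows "cauchy_G (bdry_density u\<^sub>1 u\<^sub>3) z = cauchy_G f\<^sub>1 z + \<i> * cauchy_G f\<^sub>3 z"
  unfolding bdry_density_def using cont_data assms
  by (subst cauchy_G_add) (auto simp: cauchy_G_cmult intro!: continuous_intros)

text \<open>As e2 = i + \<nu>, multiplication by it adds i times each part of
  \<open>S_disk u\<^sub>3\<close> to the corresponding part, and its first part once more to the
  second.\<close>

lemma solution_parts:
  assumes "norm z < 1"
  shows "bih_hom (solution u\<^sub>1 u\<^sub>3 \<alpha> \<beta>\<^sub>1 \<beta>\<^sub>2 (plane_of z)) = cauchy_S (bdry_density u\<^sub>1 u\<^sub>3) z + \<alpha> * z + \<beta>\<^sub>1 + \<i> * \<beta>\<^sub>2"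
    and "coeff2 (solution u\<^sub>1 u\<^sub>3 \<alpha> \<beta>\<^sub>1 \<beta>\<^sub>2 (plane_of z)) =
      cauchy_G (bdry_density u\<^sub>1 u\<^sub>3) z + cauchy_S f\<^sub>3 z + \<alpha> * of_real (Im z) + \<beta>\<^sub>2"
  using assms u by (simp_all add: solution_def S_disk_parts S_density G_density algebra_simps)

text \<open>Linearity is carried over from inside the disk by uniqueness of limits, which avoids
  splitting the singular integral.\<close>

lemma cauchy_S_bdry_density:
  assumes "norm z = 1"
  shows "cauchy_S_bdry (bdry_density u\<^sub>1 u\<^sub>3) z = cauchy_S_bdry f\<^sub>1 z + \<i> * cauchy_S_bdry f\<^sub>3 z"
proof (rule tendsto_unique[OF at_within_ball_neq_bot[OF assms]])
  show "(cauchy_S (bdry_density u\<^sub>1 u\<^sub>3) \<longlongrightarrow> cauchy_S_bdry (bdry_density u\<^sub>1 u\<^sub>3) z) (at z within ball 0 1)"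
    by (rule cauchy_S_tendsto[OF dini_data(3) assms])
  have "((\<lambda>w. cauchy_S f\<^sub>1 w + \<i> * cauchy_S f\<^sub>3 w) \<longlongrightarrow> cauchy_S_bdry f\<^sub>1 z + \<i> * cauchy_S_bdry f\<^sub>3 z) (at z within ball 0 1)"
    by (intro tendsto_intros cauchy_S_tendsto dini_data assms)
  then show "(cauchy_S (bdry_density u\<^sub>1 u\<^sub>3) \<longlongrightarrow> cauchy_S_bdry f\<^sub>1 z + \<i> * cauchy_S_bdry f\<^sub>3 z) (at z within ball 0 1)"
    by (rule Lim_transform_within[of _ _ _ _ 1]) (auto simp: S_density)
qed

lemma Re_bdry_data:
  assumes "norm z = 1"
  shows "Re (cauchy_S_bdry f\<^sub>1 z) = u\<^sub>1 (plane_of z)" "Re (cauchy_S_bdry f\<^sub>3 z) = u\<^sub>3 (plane_of z)"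
  using Re_cauchy_S_bdry[OF dini_data(1) _ assms] Re_cauchy_S_bdry[OF dini_data(2) _ assms] by simp_all

lemma solution_bdry_tendsto:
  assumes "norm z = 1"
  shows "((\<lambda>w. solution u\<^sub>1 u\<^sub>3 \<alpha> \<beta>\<^sub>1 \<beta>\<^sub>2 (plane_of w)) \<longlongrightarrow>
    of_parts (cauchy_S_bdry (bdry_density u\<^sub>1 u\<^sub>3) z + \<alpha> * z + \<beta>\<^sub>1 + \<i> * \<beta>\<^sub>2)
     (\<i> * (bdry_coeff u\<^sub>1 u\<^sub>3 2 * cnj z + bdry_coeff u\<^sub>1 u\<^sub>3 3) + cauchy_S_bdry f\<^sub>3 z + \<alpha> * of_real (Im z) + \<beta>\<^sub>2))
    (at z within ball 0 1)"
proof -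
  have "((\<lambda>w. of_parts (cauchy_S (bdry_density u\<^sub>1 u\<^sub>3) w + \<alpha> * w + \<beta>\<^sub>1 + \<i> * \<beta>\<^sub>2)
      (cauchy_G (bdry_density u\<^sub>1 u\<^sub>3) w + cauchy_S f\<^sub>3 w + \<alpha> * of_real (Im w) + \<beta>\<^sub>2)) \<longlongrightarrow>
    of_parts (cauchy_S_bdry (bdry_density u\<^sub>1 u\<^sub>3) z + \<alpha> * z + \<beta>\<^sub>1 + \<i> * \<beta>\<^sub>2)
     (\<i> * (bdry_coeff u\<^sub>1 u\<^sub>3 2 * cnj z + bdry_coeff u\<^sub>1 u\<^sub>3 3) + cauchy_S_bdry f\<^sub>3 z + \<alpha> * of_real (Im z) + \<beta>\<^sub>2))
    (at z within ball 0 1)"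
    unfolding bdry_coeff_def
    by (intro tendsto_of_parts tendsto_intros cauchy_S_tendsto cauchy_G_tendsto dini_data assms)
  then show ?thesis
    by (rule Lim_transform_within[of _ _ _ _ 1])
      (auto intro!: bih_eqI simp: solution_parts)
qed

text \<open>In U1 the imaginary parts of the boundary Schwarz integral of \<open>u\<^sub>3\<close>
  and of \<open>\<beta>\<^sub>2\<close> cancel, and Re(\<alpha> z) + Im \<alpha> Im z = Re \<alpha>
  Re z. With a real coefficient of index 2, the terms left besides the data cancel by the conditions
  on the real parts, in U1 and in U3.\<close>

lemma solution_bdry_values:
  assumes z: "norm z = 1" and k: "Im (bdry_coeff u\<^sub>1 u\<^sub>3 2) = 0"
    and \<alpha>: "Re \<alpha> = - Re (bdry_coeff u\<^sub>1 u\<^sub>3 2)" "Re \<beta>\<^sub>1 = - Re (bdry_coeff u\<^sub>1 u\<^sub>3 3)" "Re \<beta>\<^sub>2 = Im (bdry_coeff u\<^sub>1 u\<^sub>3 3)"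
  defines "L \<equiv> of_parts (cauchy_S_bdry (bdry_density u\<^sub>1 u\<^sub>3) z + \<alpha> * z + \<beta>\<^sub>1 + \<i> * \<beta>\<^sub>2)
     (\<i> * (bdry_coeff u\<^sub>1 u\<^sub>3 2 * cnj z + bdry_coeff u\<^sub>1 u\<^sub>3 3) + cauchy_S_bdry f\<^sub>3 z + \<alpha> * of_real (Im z) + \<beta>\<^sub>2)"
  shows "U1 L = u\<^sub>1 (plane_of z)" "U3 L = u\<^sub>3 (plane_of z)"
  using Re_bdry_data[OF z] k \<alpha>
  by (simp_all add: L_def U_bih_hom cauchy_S_bdry_density[OF z])

lemma solution_in_class_M:
  obtains \<phi> where "Dini \<phi>" "\<forall>\<zeta>\<in>disk. solution u\<^sub>1 u\<^sub>3 \<alpha> \<beta>\<^sub>1 \<beta>\<^sub>2 \<zeta> = schwarz_integral \<phi> \<zeta>"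
proof -
  txt \<open>Only the nonnegative Fourier coefficients of the second part matter, so \<open>- i \<alpha> / 4 t\<close> serves
    instead of the true second part \<open>\<alpha> / 2 Im t\<close> of the density \<open>\<alpha> \<tau> / 2\<close>.\<close>
  define P where "P = (\<lambda>\<tau>. of_parts (\<alpha> / 2 * bih_hom \<tau> + (\<beta>\<^sub>1 + \<i> * \<beta>\<^sub>2)) (- \<i> * \<alpha> / 4 * bih_hom \<tau> + \<beta>\<^sub>2))"
  define \<phi> where "\<phi> = (\<lambda>\<tau>. u\<^sub>1 \<tau> *\<^sub>R e1 + u\<^sub>3 \<tau> *\<^sub>R e2 + P \<tau>)"
  \<comment> \<open>The constants of \<open>P\<close> cancel in differences, so a bound for this
    linear part provides the Lipschitz constant.\<close>
  have "linear (\<lambda>v. of_parts (\<alpha> / 2 * bih_hom v) (- \<i> * \<alpha> / 4 * bih_hom v))"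
    by (rule linearI; rule bih_eqI; simp add: algebra_simps scaleR_conv_of_real)
  then obtain C where C: "0 \<le> C" "\<And>v. norm (of_parts (\<alpha> / 2 * bih_hom v) (- \<i> * \<alpha> / 4 * bih_hom v)) \<le> norm v * C"
    using bounded_linear.nonneg_bounded linear_conv_bounded_linear by blast
  have "norm (e1 :: bih) = 1" "norm e2 = 1" by (simp_all add: norm_bih_def one_bih_def e2_def)
  have "Dini \<phi>"
  proof (rule Dini_combine[OF u C(1)])
    fix \<tau>\<^sub>1 \<tau>\<^sub>2
    have "\<phi> \<tau>\<^sub>1 - \<phi> \<tau>\<^sub>2 = (u\<^sub>1 \<tau>\<^sub>1 - u\<^sub>1 \<tau>\<^sub>2) *\<^sub>R e1 + (u\<^sub>3 \<tau>\<^sub>1 - u\<^sub>3 \<tau>\<^sub>2) *\<^sub>R e2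
      + of_parts (\<alpha> / 2 * bih_hom (\<tau>\<^sub>1 - \<tau>\<^sub>2)) (- \<i> * \<alpha> / 4 * bih_hom (\<tau>\<^sub>1 - \<tau>\<^sub>2))"
      by (rule bih_eqI) (simp_all add: \<phi>_def P_def algebra_simps diff_divide_distrib)
    also have "norm \<dots> \<le> norm ((u\<^sub>1 \<tau>\<^sub>1 - u\<^sub>1 \<tau>\<^sub>2) *\<^sub>R e1) + norm ((u\<^sub>3 \<tau>\<^sub>1 - u\<^sub>3 \<tau>\<^sub>2) *\<^sub>R e2) +
        norm (of_parts (\<alpha> / 2 * bih_hom (\<tau>\<^sub>1 - \<tau>\<^sub>2)) (- \<i> * \<alpha> / 4 * bih_hom (\<tau>\<^sub>1 - \<tau>\<^sub>2)))"
      by (intro norm_triangle_le add_right_mono norm_triangle_ineq)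
    also have "\<dots> \<le> norm (u\<^sub>1 \<tau>\<^sub>1 - u\<^sub>1 \<tau>\<^sub>2) + norm (u\<^sub>3 \<tau>\<^sub>1 - u\<^sub>3 \<tau>\<^sub>2) + C * norm (\<tau>\<^sub>1 - \<tau>\<^sub>2)"
      using C(2)[of "\<tau>\<^sub>1 - \<tau>\<^sub>2"] \<open>norm e1 = 1\<close> \<open>norm e2 = 1\<close> by (simp only: norm_scaleR) (simp add: mult.commute)
    finally show "norm (\<phi> \<tau>\<^sub>1 - \<phi> \<tau>\<^sub>2) \<le> norm (u\<^sub>1 \<tau>\<^sub>1 - u\<^sub>1 \<tau>\<^sub>2) + norm (u\<^sub>3 \<tau>\<^sub>1 - u\<^sub>3 \<tau>\<^sub>2) + C * norm (\<tau>\<^sub>1 - \<tau>\<^sub>2)" .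
  qed
  have hom: "(\<lambda>t. bih_hom (\<phi> (plane_of t))) = (\<lambda>t. bdry_density u\<^sub>1 u\<^sub>3 t + (\<alpha> / 2 * t + (\<beta>\<^sub>1 + \<i> * \<beta>\<^sub>2)))"
    and co: "(\<lambda>t. coeff2 (\<phi> (plane_of t))) = (\<lambda>t. f\<^sub>3 t + (- \<i> * \<alpha> / 4 * t + \<beta>\<^sub>2))"
    by (simp_all add: fun_eq_iff \<phi>_def P_def bdry_density_def)
  have S1: "cauchy_S (\<lambda>t. f t + (a * t + c)) z = cauchy_S f z + (a * (2 * z) + c)"
    if "continuous_on (sphere 0 1) f" "norm z < 1" for f a c z
    using that by (simp add: cauchy_S_add cauchy_S_cmult cauchy_S_const cauchy_S_ident continuous_intros)
  have G1: "cauchy_G (\<lambda>t. f t + (a * t + c)) z = cauchy_G f z + a * (\<i> * cnj z)"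
    if "continuous_on (sphere 0 1) f" "norm z < 1" for f a c z
    using that by (simp add: cauchy_G_add cauchy_G_cmult cauchy_G_const cauchy_G_ident continuous_intros)
  have "solution u\<^sub>1 u\<^sub>3 \<alpha> \<beta>\<^sub>1 \<beta>\<^sub>2 \<zeta> = schwarz_integral \<phi> \<zeta>" if "\<zeta> \<in> disk" for \<zeta>
  proof -
    obtain z where z: "\<zeta> = plane_of z" "norm z < 1" using \<open>\<zeta> \<in> disk\<close> by (auto simp: disk_eq)
    note sc = dini_circle_parts[OF \<open>Dini \<phi>\<close>, THEN dini_circle_imp_continuous]
    \<comment> \<open>Joins the cnj z that G produces from \<alpha> t / 2 with the z that S produces
      from -i \<alpha> t / 4 into \<alpha> Im z.\<close>
    have im: "complex_of_real (Im z) = (\<i> * cnj z - \<i> * z) / 2" by (simp add: complex_eq_iff)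
    show ?thesis
      unfolding z(1)
      by (rule bih_eqI; unfold schwarz_integral_parts[OF sc z(2)] hom co S1[OF cont_data(2) z(2)]
          S1[OF cont_data(3) z(2)] G1[OF cont_data(3) z(2)] solution_parts[OF z(2)] im)
        (simp_all add: field_simps)
  qed
  with \<open>Dini \<phi>\<close> show ?thesis using that by blast
qed

text \<open>\<open>cauchy_G_eq\<close> brings the second part to the form demanded by
  \<open>monogenic_onI\<close>, with F the Schwarz integral of the first part and F' =
  \<open>2 * cauchy 2 f\<close>.\<close>

lemma schwarz_integral_regular:
  assumes "Dini \<phi>" and \<Phi>: "\<And>\<zeta>. \<zeta> \<in> disk \<Longrightarrow> \<Phi> \<zeta> = schwarz_integral \<phi> \<zeta>"
  shows "monogenic_on disk \<Phi>" "continuous_on (ball 0 1) (\<lambda>z. \<Phi> (plane_of z))"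
proof -
  define f where "f = (\<lambda>t. bih_hom (\<phi> (plane_of t)))"
  define g where "g = (\<lambda>t. coeff2 (\<phi> (plane_of t)))"
  have c: "continuous_on (sphere 0 1) f" "continuous_on (sphere 0 1) g"
    unfolding f_def g_def using dini_circle_parts[OF assms(1), THEN dini_circle_imp_continuous] by auto
  have parts: "bih_hom (\<Phi> (plane_of z)) = cauchy_S f z"
    "coeff2 (\<Phi> (plane_of z)) = of_real (Im z) * (2 * cauchy 2 f z) +
      (\<i> * (cauchy 2 f 0 * z + cauchy 3 f 0 - cauchy_E f z + z\<^sup>2 * cauchy_E f z) + cauchy_S g z)"
    if "norm z < 1" for z
    using that c \<Phi>[of "plane_of z"] schwarz_integral_parts[of \<phi> z, folded f_def g_def] cauchy_G_eq[of f z]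
    by (auto simp: disk_eq algebra_simps)
  have F': "(cauchy_S f has_field_derivative 2 * cauchy 2 f z) (at z)" if "norm z < 1" for z
  proof -
    have "(cauchy 1 f has_field_derivative cauchy 2 f z) (at z)"
      using cauchy_has_field_derivative[OF c(1) that, of 1] by (simp add: numeral_2_eq_2)
    then show ?thesis unfolding cauchy_S_def[abs_def] by (auto intro!: derivative_eq_intros)
  qed
  have F0: "(\<lambda>z. \<i> * (cauchy 2 f 0 * z + cauchy 3 f 0 - cauchy_E f z + z\<^sup>2 * cauchy_E f z) + cauchy_S g z)
      holomorphic_on ball 0 1"
    by (intro holomorphic_intros cauchy_E_holomorphic cauchy_S_holomorphic c)
  show "monogenic_on disk \<Phi>"
    by (rule monogenic_onI[OF cauchy_S_holomorphic[OF c(1)] F' F0 parts])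
  have "continuous_on (ball 0 1) (\<lambda>z. of_parts (cauchy_S f z) (of_real (Im z) * (2 * cauchy 2 f z) +
      (\<i> * (cauchy 2 f 0 * z + cauchy 3 f 0 - cauchy_E f z + z\<^sup>2 * cauchy_E f z) + cauchy_S g z)))"
    by (intro continuous_on_of_parts continuous_on_add continuous_on_mult continuous_on_of_real
        continuous_on_Im continuous_on_const continuous_on_id holomorphic_on_imp_continuous_on[OF F0]
        holomorphic_on_imp_continuous_on[OF cauchy_S_holomorphic[OF c(1)]]
        holomorphic_on_imp_continuous_on[OF cauchy_holomorphic[OF c(1)]]) simp
  then show "continuous_on (ball 0 1) (\<lambda>z. \<Phi> (plane_of z))"
    by (rule continuous_on_eq) (auto intro!: bih_eqI simp: parts)
qed

text \<open>Uniqueness of limits identifies the values of \<Phi> on the circle with those computed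
  in \<open>solution_bdry_values\<close>.\<close>

lemma solution_solves:
  assumes k: "Im (bdry_coeff u\<^sub>1 u\<^sub>3 2) = 0"
    and \<alpha>: "Re \<alpha> = - Re (bdry_coeff u\<^sub>1 u\<^sub>3 2)" "Re \<beta>\<^sub>1 = - Re (bdry_coeff u\<^sub>1 u\<^sub>3 3)" "Re \<beta>\<^sub>2 = Im (bdry_coeff u\<^sub>1 u\<^sub>3 3)"
    and lim: "boundary_limits \<Phi>"
    and \<Phi>: "\<forall>\<zeta>\<in>disk. \<Phi> \<zeta> = solution u\<^sub>1 u\<^sub>3 \<alpha> \<beta>\<^sub>1 \<beta>\<^sub>2 \<zeta>"
  shows "\<Phi> \<in> class_M" "solves_13 u\<^sub>1 u\<^sub>3 \<Phi>"
proof -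
  obtain \<phi> where \<phi>: "Dini \<phi>" "\<forall>\<zeta>\<in>disk. solution u\<^sub>1 u\<^sub>3 \<alpha> \<beta>\<^sub>1 \<beta>\<^sub>2 \<zeta> = schwarz_integral \<phi> \<zeta>"
    using solution_in_class_M by blast
  then show "\<Phi> \<in> class_M" using \<Phi> lim by (auto simp: class_M_def)
  have \<Phi>\<phi>: "\<Phi> \<zeta> = schwarz_integral \<phi> \<zeta>" if "\<zeta> \<in> disk" for \<zeta>
    using \<Phi> \<phi>(2) that by simp
  have "U1 (\<Phi> (plane_of z)) = u\<^sub>1 (plane_of z) \<and> U3 (\<Phi> (plane_of z)) = u\<^sub>3 (plane_of z)" if z: "norm z = 1" for z
  proof -
    have "((\<lambda>w. \<Phi> (plane_of w)) \<longlongrightarrow> \<Phi> (plane_of z)) (at z within ball 0 1)"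
      using lim z by (simp add: boundary_limits_iff)
    then have "((\<lambda>w. solution u\<^sub>1 u\<^sub>3 \<alpha> \<beta>\<^sub>1 \<beta>\<^sub>2 (plane_of w)) \<longlongrightarrow> \<Phi> (plane_of z)) (at z within ball 0 1)"
      by (rule Lim_transform_within[of _ _ _ _ 1]) (auto simp: \<Phi> disk_eq)
    from tendsto_unique[OF at_within_ball_neq_bot[OF z] this solution_bdry_tendsto[OF z]]
    show ?thesis using solution_bdry_values[OF z k \<alpha>] by simp
  qed
  then show "solves_13 u\<^sub>1 u\<^sub>3 \<Phi>"
    unfolding solves_13_def
    using continuous_on_cdiskI[OF lim schwarz_integral_regular(2)[OF \<phi>(1) \<Phi>\<phi>]]
      schwarz_integral_regular(1)[OF \<phi>(1) \<Phi>\<phi>] by (auto simp: bdisk_eq)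
qed

lemma solution_extends:
  obtains \<Phi> where "boundary_limits \<Phi>" "\<forall>\<zeta>\<in>disk. \<Phi> \<zeta> = solution u\<^sub>1 u\<^sub>3 \<alpha> \<beta>\<^sub>1 \<beta>\<^sub>2 \<zeta>"
proof -
  define L where "L = (\<lambda>z. of_parts (cauchy_S_bdry (bdry_density u\<^sub>1 u\<^sub>3) z + \<alpha> * z + \<beta>\<^sub>1 + \<i> * \<beta>\<^sub>2)
     (\<i> * (bdry_coeff u\<^sub>1 u\<^sub>3 2 * cnj z + bdry_coeff u\<^sub>1 u\<^sub>3 3) + cauchy_S_bdry f\<^sub>3 z + \<alpha> * of_real (Im z) + \<beta>\<^sub>2))"
  \<comment> \<open>On the circle \<open>bih_hom\<close> recovers z from \<open>plane_of z\<close>,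
    so \<Phi> takes the limit \<open>L z\<close> there.\<close>
  define \<Phi> where "\<Phi> = (\<lambda>\<zeta>. if \<zeta> \<in> disk then solution u\<^sub>1 u\<^sub>3 \<alpha> \<beta>\<^sub>1 \<beta>\<^sub>2 \<zeta> else L (bih_hom \<zeta>))"
  have plane_of: "plane_of z \<in> disk \<longleftrightarrow> norm z < 1" for z
    by (auto simp: disk_def bih_plane_eq)
  have "boundary_limits \<Phi>"
    unfolding boundary_limits_iff
  proof (intro allI impI)
    fix z :: complex assume z: "norm z = 1"
    have "((\<lambda>w. solution u\<^sub>1 u\<^sub>3 \<alpha> \<beta>\<^sub>1 \<beta>\<^sub>2 (plane_of w)) \<longlongrightarrow> L z) (at z within ball 0 1)"
      unfolding L_def by (rule solution_bdry_tendsto[OF z])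
    then have "((\<lambda>w. \<Phi> (plane_of w)) \<longlongrightarrow> L z) (at z within ball 0 1)"
      by (rule Lim_transform_within[of _ _ _ _ 1]) (auto simp: \<Phi>_def plane_of)
    then show "((\<lambda>w. \<Phi> (plane_of w)) \<longlongrightarrow> \<Phi> (plane_of z)) (at z within ball 0 1)"
      using z by (simp add: \<Phi>_def plane_of)
  qed
  then show ?thesis using that[of \<Phi>] by (simp add: \<Phi>_def)
qed

section \<open>Necessity of the condition and the general form of a solution\<close>

lemma solves_imp_solution:
  assumes M: "\<Phi> \<in> class_M" and sol: "solves_13 u\<^sub>1 u\<^sub>3 \<Phi>"
  obtains \<alpha> \<beta>\<^sub>1 \<beta>\<^sub>2 where "Im (bdry_coeff u\<^sub>1 u\<^sub>3 2) = 0"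
    "Re \<alpha> = - Re (bdry_coeff u\<^sub>1 u\<^sub>3 2)" "Re \<beta>\<^sub>1 = - Re (bdry_coeff u\<^sub>1 u\<^sub>3 3)" "Re \<beta>\<^sub>2 = Im (bdry_coeff u\<^sub>1 u\<^sub>3 3)"
    "\<forall>\<zeta>\<in>disk. \<Phi> \<zeta> = solution u\<^sub>1 u\<^sub>3 \<alpha> \<beta>\<^sub>1 \<beta>\<^sub>2 \<zeta>"
proof -
  obtain \<phi> where \<phi>: "Dini \<phi>" "\<And>\<zeta>. \<zeta> \<in> disk \<Longrightarrow> \<Phi> \<zeta> = schwarz_integral \<phi> \<zeta>" and lim: "boundary_limits \<Phi>"
    using M by (auto simp: class_M_def)
  define f where "f = (\<lambda>t. bih_hom (\<phi> (plane_of t)))"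
  define g where "g = (\<lambda>t. coeff2 (\<phi> (plane_of t)))"
  have dini: "dini_circle f" "dini_circle g"
    unfolding f_def g_def using dini_circle_parts[OF \<phi>(1)] by auto
  note c = dini[THEN dini_circle_imp_continuous]
  have parts: "bih_hom (\<Phi> (plane_of z)) = cauchy_S f z" "coeff2 (\<Phi> (plane_of z)) = cauchy_G f z + cauchy_S g z"
    if "norm z < 1" for z
    using that c \<phi>(2)[of "plane_of z"] schwarz_integral_parts[of \<phi> z, folded f_def g_def] by (auto simp: disk_eq)
  define C2 where "C2 = cauchy 2 f 0"
  define C3 where "C3 = cauchy 3 f 0"
  have bdry: "Re (cauchy_S_bdry f z) + Im (cauchy_S_bdry g z) + Re (C2 * cnj z + C3) = u\<^sub>1 (plane_of z)"
    "Re (cauchy_S_bdry g z) - Im (C2 * cnj z + C3) = u\<^sub>3 (plane_of z)" if z: "norm z = 1" for z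
  proof -
    have l: "((\<lambda>w. \<Phi> (plane_of w)) \<longlongrightarrow> \<Phi> (plane_of z)) (at z within ball 0 1)"
      using lim z by (simp add: boundary_limits_iff)
    have "((\<lambda>w. of_parts (cauchy_S f w) (cauchy_G f w + cauchy_S g w)) \<longlongrightarrow>
      of_parts (cauchy_S_bdry f z) (\<i> * (C2 * cnj z + C3) + cauchy_S_bdry g z)) (at z within ball 0 1)"
      unfolding C2_def C3_def
      by (intro tendsto_of_parts tendsto_intros cauchy_S_tendsto cauchy_G_tendsto dini z)
    then have "((\<lambda>w. \<Phi> (plane_of w)) \<longlongrightarrow>
      of_parts (cauchy_S_bdry f z) (\<i> * (C2 * cnj z + C3) + cauchy_S_bdry g z)) (at z within ball 0 1)"
      by (rule Lim_transform_within[of _ _ _ _ 1]) (auto intro!: bih_eqI simp: parts)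
    from tendsto_unique[OF at_within_ball_neq_bot[OF z] l this]
    have "\<Phi> (plane_of z) = of_parts (cauchy_S_bdry f z) (\<i> * (C2 * cnj z + C3) + cauchy_S_bdry g z)" .
    moreover have "U1 (\<Phi> (plane_of z)) = u\<^sub>1 (plane_of z)" "U3 (\<Phi> (plane_of z)) = u\<^sub>3 (plane_of z)"
      using sol z by (auto simp: solves_13_def bdisk_eq)
    ultimately show "Re (cauchy_S_bdry f z) + Im (cauchy_S_bdry g z) + Re (C2 * cnj z + C3) = u\<^sub>1 (plane_of z)"
      "Re (cauchy_S_bdry g z) - Im (C2 * cnj z + C3) = u\<^sub>3 (plane_of z)"
      by (simp_all add: U_bih_hom)
  qed
  have "(\<lambda>z. cauchy_S g z - cauchy_S f\<^sub>3 z - \<i> * cnj C2 * z) holomorphic_on ball 0 1"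
    by (intro holomorphic_intros cauchy_S_holomorphic c cont_data)
  moreover have "((\<lambda>z. cauchy_S g z - cauchy_S f\<^sub>3 z - \<i> * cnj C2 * z) \<longlongrightarrow>
      cauchy_S_bdry g z - cauchy_S_bdry f\<^sub>3 z - \<i> * cnj C2 * z) (at z within ball 0 1)" if "norm z = 1" for z
    by (intro tendsto_intros cauchy_S_tendsto dini dini_data that)
  moreover have "Re (cauchy_S_bdry g z - cauchy_S_bdry f\<^sub>3 z - \<i> * cnj C2 * z) = Im C3" if "norm z = 1" for z
    using bdry(2)[OF that] Re_bdry_data[OF that] by simp
  ultimately have "\<exists>d. Re d = Im C3 \<and> (\<forall>z\<in>ball 0 1. cauchy_S g z - cauchy_S f\<^sub>3 z - \<i> * cnj C2 * z = d)"
    by (rule holomorphic_disc_const)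
  then obtain d1 where d1: "Re d1 = Im C3"
    "\<And>z. norm z < 1 \<Longrightarrow> cauchy_S g z - cauchy_S f\<^sub>3 z - \<i> * cnj C2 * z = d1"
    by auto
  have "(\<lambda>z. cauchy_S f z - cauchy_S (bdry_density u\<^sub>1 u\<^sub>3) z - \<i> * (cauchy_S g z - cauchy_S f\<^sub>3 z) + cnj C2 * z)
      holomorphic_on ball 0 1"
    by (intro holomorphic_intros cauchy_S_holomorphic c cont_data)
  moreover have "((\<lambda>z. cauchy_S f z - cauchy_S (bdry_density u\<^sub>1 u\<^sub>3) z - \<i> * (cauchy_S g z - cauchy_S f\<^sub>3 z) + cnj C2 * z) \<longlongrightarrow>
      cauchy_S_bdry f z - cauchy_S_bdry (bdry_density u\<^sub>1 u\<^sub>3) z - \<i> * (cauchy_S_bdry g z - cauchy_S_bdry f\<^sub>3 z) + cnj C2 * z)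
      (at z within ball 0 1)" if "norm z = 1" for z
    by (intro tendsto_intros cauchy_S_tendsto dini dini_data that)
  moreover have "Re (cauchy_S_bdry f z - cauchy_S_bdry (bdry_density u\<^sub>1 u\<^sub>3) z - \<i> * (cauchy_S_bdry g z - cauchy_S_bdry f\<^sub>3 z)
      + cnj C2 * z) = - Re C3" if "norm z = 1" for z
    using bdry(1)[OF that] Re_bdry_data[OF that] cauchy_S_bdry_density[OF that] by simp
  ultimately have "\<exists>d. Re d = - Re C3 \<and> (\<forall>z\<in>ball 0 1. cauchy_S f z - cauchy_S (bdry_density u\<^sub>1 u\<^sub>3) z
      - \<i> * (cauchy_S g z - cauchy_S f\<^sub>3 z) + cnj C2 * z = d)"
    by (rule holomorphic_disc_const)
  then obtain d2 where d2: "Re d2 = - Re C3"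
    "\<And>z. norm z < 1 \<Longrightarrow> cauchy_S f z - cauchy_S (bdry_density u\<^sub>1 u\<^sub>3) z - \<i> * (cauchy_S g z - cauchy_S f\<^sub>3 z) + cnj C2 * z = d2"
    by auto
  define f' where "f' = (\<lambda>t. f t + (-1) * bdry_density u\<^sub>1 u\<^sub>3 t)"
  have cf': "continuous_on (sphere 0 1) f'"
    unfolding f'_def by (intro continuous_intros c cont_data)
  have lin: "cauchy n f' z = cauchy n f z - cauchy n (bdry_density u\<^sub>1 u\<^sub>3) z"
    "cauchy_S f' z = cauchy_S f z - cauchy_S (bdry_density u\<^sub>1 u\<^sub>3) z"
    "cauchy_G f' z = cauchy_G f z - cauchy_G (bdry_density u\<^sub>1 u\<^sub>3) z" if "norm z < 1" for z n
  proof -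
    have c': "continuous_on (sphere 0 1) (\<lambda>t. (-1) * bdry_density u\<^sub>1 u\<^sub>3 t)"
      by (intro continuous_intros cont_data)
    show "cauchy n f' z = cauchy n f z - cauchy n (bdry_density u\<^sub>1 u\<^sub>3) z"
      "cauchy_S f' z = cauchy_S f z - cauchy_S (bdry_density u\<^sub>1 u\<^sub>3) z"
      "cauchy_G f' z = cauchy_G f z - cauchy_G (bdry_density u\<^sub>1 u\<^sub>3) z"
      unfolding f'_def cauchy_add[OF c(1) c' that] cauchy_S_add[OF c(1) c' that] cauchy_G_add[OF c(1) c' that]
        cauchy_cmult[OF cont_data(3) that] cauchy_S_cmult[OF cont_data(3) that] cauchy_G_cmult[OF cont_data(3) that]
      by simp_all
  qed
  have aff: "cauchy_S f' z = 2 * (- cnj C2) * z + (d2 + \<i> * d1)" if "norm z < 1" for z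
  proof -
    have "cauchy_S g z - cauchy_S f\<^sub>3 z = \<i> * cnj C2 * z + d1"
      using d1(2)[OF that] by (simp add: algebra_simps)
    then have "cauchy_S f' z - \<i> * (\<i> * cnj C2 * z + d1) + cnj C2 * z = d2"
      using d2(2)[OF that] lin(2)[OF that] by simp
    then show ?thesis by (simp add: algebra_simps)
  qed
  have k2: "C2 - bdry_coeff u\<^sub>1 u\<^sub>3 2 = - cnj C2" and k3: "C3 = bdry_coeff u\<^sub>1 u\<^sub>3 3"
    using affine_cauchy_S(1,2)[OF cf' aff] lin(1)[of 0] by (simp_all add: C2_def C3_def bdry_coeff_def)
  have k2': "bdry_coeff u\<^sub>1 u\<^sub>3 2 = of_real (2 * Re C2)"
    using k2 by (simp add: complex_eq_iff)
  show ?thesis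
  proof (rule that[of "- 2 * cnj C2" d2 d1])
    show "Im (bdry_coeff u\<^sub>1 u\<^sub>3 2) = 0" by (simp add: k2')
    show "Re (- 2 * cnj C2) = - Re (bdry_coeff u\<^sub>1 u\<^sub>3 2)" by (simp add: k2')
    show "Re d2 = - Re (bdry_coeff u\<^sub>1 u\<^sub>3 3)" "Re d1 = Im (bdry_coeff u\<^sub>1 u\<^sub>3 3)" using d1(1) d2(1) by (simp_all add: k3)
    show "\<forall>\<zeta>\<in>disk. \<Phi> \<zeta> = solution u\<^sub>1 u\<^sub>3 (- 2 * cnj C2) d2 d1 \<zeta>"
    proof
      fix \<zeta> assume "\<zeta> \<in> disk"
      then obtain z where z: "\<zeta> = plane_of z" "norm z < 1" by (auto simp: disk_eq)
      have "cauchy_G f' z = \<i> * (- cnj C2) * cnj z"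
        by (rule cauchy_G_of_affine[OF cf' aff z(2)])
      then have G: "cauchy_G f z = cauchy_G (bdry_density u\<^sub>1 u\<^sub>3) z - \<i> * cnj C2 * cnj z"
        using lin(3)[OF z(2)] by (simp add: algebra_simps)
      have S: "cauchy_S g z = cauchy_S f\<^sub>3 z + \<i> * cnj C2 * z + d1"
        using d1(2)[OF z(2)] by (simp add: algebra_simps)
      have S': "cauchy_S f z = cauchy_S (bdry_density u\<^sub>1 u\<^sub>3) z + 2 * (- cnj C2) * z + (d2 + \<i> * d1)"
        using aff[OF z(2)] lin(2)[OF z(2)] by (simp add: algebra_simps)
      have im: "complex_of_real (Im z) = (\<i> * cnj z - \<i> * z) / 2" by (simp add: complex_eq_iff)
      show "\<Phi> \<zeta> = solution u\<^sub>1 u\<^sub>3 (- 2 * cnj C2) d2 d1 \<zeta>"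
        unfolding z(1) by (rule bih_eqI) (simp_all add: parts[OF z(2)] solution_parts[OF z(2)] S S' G im field_simps)
    qed
  qed
qed

lemma circ_form_integral_eq: "circ_form_integral u\<^sub>1 u\<^sub>3 = 2 * pi * Im (bdry_coeff u\<^sub>1 u\<^sub>3 2)"
proof -
  have "((\<lambda>t. bdry_density u\<^sub>1 u\<^sub>3 t / (t - 0) ^ 2) has_contour_integral 2 * of_real pi * \<i> * bdry_coeff u\<^sub>1 u\<^sub>3 2) (circlepath 0 1)"
    unfolding bdry_coeff_def by (rule has_contour_integral_cauchy) (use cont_data in auto)
  from has_integral_linear[OF has_integral_of_contour[OF this], of "\<lambda>w. - Re w"]
  have "((\<lambda>\<theta>. - Re (bdry_density u\<^sub>1 u\<^sub>3 (cis \<theta>) / (cis \<theta> - 0) ^ 2 * (\<i> * cis \<theta>))) has_integral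
      - Re (2 * of_real pi * \<i> * bdry_coeff u\<^sub>1 u\<^sub>3 2)) {0..2*pi}"
    by (simp add: o_def bounded_linear_minus bounded_linear_Re)
  then have "((\<lambda>\<theta>. u\<^sub>1 (circ \<theta>) * (- sin \<theta>) + u\<^sub>3 (circ \<theta>) * cos \<theta>) has_integral
      - Re (2 * of_real pi * \<i> * bdry_coeff u\<^sub>1 u\<^sub>3 2)) {0..2*pi}"
  proof (rule has_integral_eq[rotated])
    fix \<theta>
    have eq: "bdry_density u\<^sub>1 u\<^sub>3 (cis \<theta>) / (cis \<theta> - 0) ^ 2 * (\<i> * cis \<theta>) = bdry_density u\<^sub>1 u\<^sub>3 (cis \<theta>) * (\<i> * cnj (cis \<theta>))"
      by (simp add: cis_cnj divide_inverse power2_eq_square flip: cis_inverse)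
    show "- Re (bdry_density u\<^sub>1 u\<^sub>3 (cis \<theta>) / (cis \<theta> - 0) ^ 2 * (\<i> * cis \<theta>))
        = u\<^sub>1 (circ \<theta>) * (- sin \<theta>) + u\<^sub>3 (circ \<theta>) * cos \<theta>"
      unfolding eq by (simp add: bdry_density_def circ_eq algebra_simps)
  qed
  then show ?thesis unfolding circ_form_integral_def by (simp add: integral_unique)
qed

end

lemma contour_integral_hat:
  "contour_integral (circlepath 0 1) (\<lambda>t. of_real (hat u t) / t ^ n) =
    2 * of_real pi * \<i> * cauchy n (\<lambda>t. of_real (u (plane_of t))) 0"
  by (simp add: cauchy_def hat_def plane_of_def)

theorem theorem2:
  fixes u\<^sub>1 u\<^sub>3 :: "bih \<Rightarrow> real" and b b\<^sub>1 b\<^sub>2 :: real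
  assumes "Dini u\<^sub>1" and "Dini u\<^sub>3"
    and "b = - (1 / (2 * pi)) * Re (contour_integral (circlepath 0 1) (\<lambda>t. of_real (hat u\<^sub>3 t) / t^2))
             - (1 / (2 * pi)) * Im (contour_integral (circlepath 0 1) (\<lambda>t. of_real (hat u\<^sub>1 t) / t^2))"
    and "b\<^sub>1 = - (1 / (2 * pi)) * Re (contour_integral (circlepath 0 1) (\<lambda>t. of_real (hat u\<^sub>3 t) / t^3))
             - (1 / (2 * pi)) * Im (contour_integral (circlepath 0 1) (\<lambda>t. of_real (hat u\<^sub>1 t) / t^3))"
    and "b\<^sub>2 = (1 / (2 * pi)) * Im (contour_integral (circlepath 0 1) (\<lambda>t. of_real (hat u\<^sub>3 t) / t^3))
             - (1 / (2 * pi)) * Re (contour_integral (circlepath 0 1) (\<lambda>t. of_real (hat u\<^sub>1 t) / t^3))"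
  shows "((\<exists>\<Phi>\<in>class_M. solves_13 u\<^sub>1 u\<^sub>3 \<Phi>) \<longleftrightarrow> circ_form_integral u\<^sub>1 u\<^sub>3 = 0) \<and>
    (circ_form_integral u\<^sub>1 u\<^sub>3 = 0 \<longrightarrow>
      (\<forall>\<Phi>. (\<Phi> \<in> class_M \<and> solves_13 u\<^sub>1 u\<^sub>3 \<Phi>) \<longleftrightarrow>
        boundary_limits \<Phi> \<and>
        (\<exists>a a\<^sub>1 a\<^sub>2 :: real. \<forall>\<zeta>\<in>disk.
          \<Phi> \<zeta> = S_disk u\<^sub>1 \<zeta> * e1 + S_disk u\<^sub>3 \<zeta> * e2 + b *\<^sub>R \<zeta> + b\<^sub>1 *\<^sub>R e1 + b\<^sub>2 *\<^sub>R e2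
            + bih_of_complex \<i> * (a *\<^sub>R \<zeta> + a\<^sub>1 *\<^sub>R e1 + a\<^sub>2 *\<^sub>R e2))))"
proof -
  let ?k = "bdry_coeff u\<^sub>1 u\<^sub>3"
  note u = assms(1,2)
  have b: "b = - Re (?k 2)" "b\<^sub>1 = - Re (?k 3)" "b\<^sub>2 = Im (?k 3)"
    unfolding assms(3-5) contour_integral_hat bdry_coeff_eq[OF u] by (simp_all add: field_simps)
  have cond: "circ_form_integral u\<^sub>1 u\<^sub>3 = 0 \<longleftrightarrow> Im (?k 2) = 0"
    by (simp add: circ_form_integral_eq[OF u])
  have fwd: "Im (?k 2) = 0 \<and> (\<exists>a a\<^sub>1 a\<^sub>2. \<forall>\<zeta>\<in>disk. \<Phi> \<zeta> = solution u\<^sub>1 u\<^sub>3 (Complex b a) (Complex b\<^sub>1 a\<^sub>1) (Complex b\<^sub>2 a\<^sub>2) \<zeta>)"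
    if \<Phi>: "\<Phi> \<in> class_M" "solves_13 u\<^sub>1 u\<^sub>3 \<Phi>" for \<Phi>
  proof -
    obtain \<alpha> \<beta>\<^sub>1 \<beta>\<^sub>2 where *: "Im (?k 2) = 0"
      "Re \<alpha> = - Re (?k 2)" "Re \<beta>\<^sub>1 = - Re (?k 3)" "Re \<beta>\<^sub>2 = Im (?k 3)"
      "\<forall>\<zeta>\<in>disk. \<Phi> \<zeta> = solution u\<^sub>1 u\<^sub>3 \<alpha> \<beta>\<^sub>1 \<beta>\<^sub>2 \<zeta>"
      using solves_imp_solution[OF u \<Phi>] by blast
    have "\<alpha> = Complex b (Im \<alpha>)" "\<beta>\<^sub>1 = Complex b\<^sub>1 (Im \<beta>\<^sub>1)" "\<beta>\<^sub>2 = Complex b\<^sub>2 (Im \<beta>\<^sub>2)"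
      using * b by (simp_all add: complex_eq_iff)
    with *(1,5) show ?thesis by metis
  qed
  have bwd: "\<Phi> \<in> class_M \<and> solves_13 u\<^sub>1 u\<^sub>3 \<Phi>" if "Im (?k 2) = 0" "boundary_limits \<Phi>"
    "\<forall>\<zeta>\<in>disk. \<Phi> \<zeta> = solution u\<^sub>1 u\<^sub>3 (Complex b a) (Complex b\<^sub>1 a\<^sub>1) (Complex b\<^sub>2 a\<^sub>2) \<zeta>" for \<Phi> a a\<^sub>1 a\<^sub>2
    using solution_solves[OF u that(1) _ _ _ that(2), of "Complex b a" "Complex b\<^sub>1 a\<^sub>1" "Complex b\<^sub>2 a\<^sub>2"] that(3) b
    by simp
  have ex: "\<exists>\<Phi>\<in>class_M. solves_13 u\<^sub>1 u\<^sub>3 \<Phi>" if k: "Im (?k 2) = 0"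
  proof -
    obtain \<Phi> where \<Phi>: "boundary_limits \<Phi>"
      "\<forall>\<zeta>\<in>disk. \<Phi> \<zeta> = solution u\<^sub>1 u\<^sub>3 (Complex b 0) (Complex b\<^sub>1 0) (Complex b\<^sub>2 0) \<zeta>"
      using solution_extends[OF u] by blast
    then show ?thesis using bwd[OF k] by blast
  qed
  have lim: "boundary_limits \<Phi>" if "\<Phi> \<in> class_M" for \<Phi>
    using that by (simp add: class_M_def)
  show ?thesis
    unfolding cond solution_Complex[symmetric] using fwd bwd ex lim by blast
qed

end
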